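(* Suppose $k_{i,+}=k_{i,-}$ for $i=1,2,3$. Then the preconditioned matrix $\mathbf{P}^{-1/2}\mathbf{A}\mathbf{P}^{-1/2}$ is symmetric and every eigenvalue $\lambda$ of it satisfies $$\frac12<\lambda\left(\mathbf{P}^{-1/2}\mathbf{A}\mathbf{P}^{-1/2}\right)<\frac32 .$$
   Context: Data: $\alpha,\beta,\gamma\in(0,1)$, also written $\delta_1=\alpha,\ \delta_2=\beta,\ \delta_3=\gamma$; real numbers $a_i<b_i$ and positive constants $k_{i,+},k_{i,-}>0$ for $i=1,2,3$; $T>0$; positive integers $M,n_1,n_2,n_3$; $\Delta t=T/M$, $h_i=(b_i-a_i)/(n_i+1)$, $N=n_1n_2n_3$, and $\eta_{\delta_i}=\frac{\Delta t}{2\Gamma(\delta_i+1)h_i^{2-\delta_i}}$, i.e. $\eta_\alpha,\eta_\beta,\eta_\gamma$ for $i=1,2,3$. For $\delta\in(0,1)$ set $s_0^{(\delta)}=(\tfrac12)^\delta$, $s_1^{(\delta)}=(\tfrac32)^\delta-2(\tfrac12)^\delta$, $s_k^{(\delta)}=(k+\tfrac12)^\delta-2(k-\tfrac12)^\delta+(k-\tfrac32)^\delta$ for $k\ge2$; $q_0^{(\delta)}=-s_0^{(\delta)}$ and $q_k^{(\delta)}=s_{k-1}^{(\delta)}-s_k^{(\delta)}$ for $k\ge1$. $\mathbf{T}_{n}^{\delta}\in\mathbb{R}^{n\times n}$ is the lower Hessenberg Toeplitz matrix with $(j,k)$ entry $q_{j-k+1}^{(\delta)}$ if $j-k+1\ge0$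 and $0$ otherwise. $\mathbf{A}_n\in\mathbb{R}^{n\times n}$ is the symmetric tridiagonal Toeplitz matrix with diagonal entries $6/8$ and sub-/superdiagonal entries $1/8$. $\mathbf{B}_{n_i}^{\delta_i}=k_{i,+}\mathbf{T}_{n_i}^{\delta_i}+k_{i,-}(\mathbf{T}_{n_i}^{\delta_i})^{\top}$. For a real square matrix $\mathbf{Z}$, $\mathcal{H}(\mathbf{Z})=(\mathbf{Z}+\mathbf{Z}^\top)/2$. For a real symmetric Toeplitz matrix $T_n=[t_{|j-k|}]_{j,k=1}^n$, its $\tau$ matrix is $\tau(T_n)=\mathbf{S}_n\,\mathrm{diag}(\lambda_1,\dots,\lambda_n)\,\mathbf{S}_n$, where $[\mathbf{S}_n]_{j,k}=\sqrt{\frac{2}{n+1}}\sin\left(\frac{jk\pi}{n+1}\right)$ and $\lambda_k=t_0+2\sum_{j=1}^{n-1}t_j\cos\left(\frac{jk\pi}{n+1}\right)$. With $\otimes$ the Kronecker product, $$\mathbf{A}=\mathbf{A}_{n_3}\otimes\mathbf{A}_{n_2}\otimes\mathbf{A}_{n_1}+\eta_\alpha\,\mathbf{A}_{n_3}\otimes\mathbf{A}_{n_2}\otimes\mathbf{B}_{n_1}^{\alpha}+\eta_\beta\,\mathbf{A}_{n_3}\otimes\mathbf{B}_{n_2}^{\beta}\otimes\mathbf{A}_{n_1}+\eta_\gamma\,\mathbf{B}_{n_3}^{\gamma}\otimes\mathbf{A}_{n_2}\otimes\mathbf{A}_{n_1},$$ $$\mathbf{P}=\mathbf{A}_{n_3}\otimes\mathbf{A}_{n_2}\otimes\mathbf{A}_{n_1}+\eta_\alpha\,\mathbf{A}_{n_3}\otimes\mathbf{A}_{n_2}\otimes\tau(\mathcal{H}(\mathbf{B}_{n_1}^{\alpha}))+\eta_\beta\,\mathbf{A}_{n_3}\otimes\tau(\mathcal{H}(\mathbf{B}_{n_2}^{\beta}))\otimes\mathbf{A}_{n_1}+\eta_\gamma\,\tau(\mathcal{H}(\mathbf{B}_{n_3}^{\gamma}))\otimes\mathbf{A}_{n_2}\otimes\mathbf{A}_{n_1}.$$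 $\mathbf{P}$ is symmetric positive definite and $\mathbf{P}^{-1/2}$ is the inverse of its symmetric positive definite square root. *)

theory Defs
  imports
    "HOL-Analysis.Gamma_Function"
    "Jordan_Normal_Form.Char_Poly"
begin

no_notation vec_nth (infixl \<open>$\<close> 90)

fun s_coeff :: "real \<Rightarrow> nat \<Rightarrow> real" where
  "s_coeff d 0 = (1/2) powr d"
| "s_coeff d (Suc 0) = (3/2) powr d - 2 * (1/2) powr d"
| "s_coeff d k = (real k + 1/2) powr d - 2 * (real k - 1/2) powr d + (real k - 3/2) powr d"

fun q_coeff :: "real \<Rightarrow> nat \<Rightarrow> real" where
  "q_coeff d 0 = - s_coeff d 0"
| "q_coeff d (Suc k) = s_coeff d k - s_coeff d (Suc k)"

(* Matrix indices start at 0 here.  Only the difference j - k enters, and the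
   guard k <= j + 1 keeps the subtraction on nat exact. *)
definition T_mat :: "nat \<Rightarrow> real \<Rightarrow> real mat" where
  "T_mat n d = Matrix.mat n n (\<lambda>(j, k). if k \<le> j + 1 then q_coeff d (j + 1 - k) else 0)"

definition A_mat :: "nat \<Rightarrow> real mat" where
  "A_mat n = Matrix.mat n n (\<lambda>(j, k).
     if j = k then 6/8 else if j = k + 1 \<or> k = j + 1 then 1/8 else 0)"

definition B_mat :: "nat \<Rightarrow> real \<Rightarrow> real \<Rightarrow> real \<Rightarrow> real mat" where
  "B_mat n d kp km = kp \<cdot>\<^sub>m T_mat n d + km \<cdot>\<^sub>m transpose_mat (T_mat n d)"

definition sym_part :: "real mat \<Rightarrow> real mat" where
  "sym_part Z = (1/2) \<cdot>\<^sub>m (Z + transpose_mat Z)"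

definition sine_mat :: "nat \<Rightarrow> real mat" where
  "sine_mat n = Matrix.mat n n (\<lambda>(j, k).
     sqrt (2 / (real n + 1)) * sin (real (j + 1) * real (k + 1) * pi / (real n + 1)))"

(* Meant for a symmetric Toeplitz matrix X = [t_|j-k|], whose first column is t_0, ..., t_(n-1).
   The k-th entry of the diagonal, with k counted from 0, is lambda_(k+1). *)
definition tau_mat :: "real mat \<Rightarrow> real mat" where
  "tau_mat X = (let n = dim_row X in
     sine_mat n *
     mat_diag n (\<lambda>k. X $$ (0, 0) +
       2 * (\<Sum>j = 1..n - 1. X $$ (j, 0) * cos (real j * real (k + 1) * pi / (real n + 1)))) *
     sine_mat n)"

definition kronecker :: "real mat \<Rightarrow> real mat \<Rightarrow> real mat" (infixl \<open>\<otimes>\<^sub>k\<close> 70) where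
  "X \<otimes>\<^sub>k Y = Matrix.mat (dim_row X * dim_row Y) (dim_col X * dim_col Y) (\<lambda>(i, j).
     X $$ (i div dim_row Y, j div dim_col Y) * Y $$ (i mod dim_row Y, j mod dim_col Y))"

definition eta :: "real \<Rightarrow> real \<Rightarrow> real \<Rightarrow> real" where
  "eta dt h d = dt / (2 * Gamma (d + 1) * h powr (2 - d))"

(* The common shape of the coefficient matrix and of the preconditioner: e, n and C are indexed by
   the spatial directions 1, 2, 3, and C i is B_(n_i) or tau(H(B_(n_i))) respectively. *)
definition kron_sum :: "(nat \<Rightarrow> real) \<Rightarrow> (nat \<Rightarrow> nat) \<Rightarrow> (nat \<Rightarrow> real mat) \<Rightarrow> real mat" where
  "kron_sum e n C =
     A_mat (n 3) \<otimes>\<^sub>k A_mat (n 2) \<otimes>\<^sub>k A_mat (n 1)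
     + e 1 \<cdot>\<^sub>m (A_mat (n 3) \<otimes>\<^sub>k A_mat (n 2) \<otimes>\<^sub>k C 1)
     + e 2 \<cdot>\<^sub>m (A_mat (n 3) \<otimes>\<^sub>k C 2 \<otimes>\<^sub>k A_mat (n 1))
     + e 3 \<cdot>\<^sub>m (C 3 \<otimes>\<^sub>k A_mat (n 2) \<otimes>\<^sub>k A_mat (n 1))"

definition coeff_mat ::
  "(nat \<Rightarrow> real) \<Rightarrow> (nat \<Rightarrow> nat) \<Rightarrow> (nat \<Rightarrow> real) \<Rightarrow> (nat \<Rightarrow> real) \<Rightarrow> (nat \<Rightarrow> real) \<Rightarrow> real mat" where
  "coeff_mat e n d kp km = kron_sum e n (\<lambda>i. B_mat (n i) (d i) (kp i) (km i))"

definition precond_mat ::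
  "(nat \<Rightarrow> real) \<Rightarrow> (nat \<Rightarrow> nat) \<Rightarrow> (nat \<Rightarrow> real) \<Rightarrow> (nat \<Rightarrow> real) \<Rightarrow> (nat \<Rightarrow> real) \<Rightarrow> real mat" where
  "precond_mat e n d kp km =
     kron_sum e n (\<lambda>i. tau_mat (sym_part (B_mat (n i) (d i) (kp i) (km i))))"

(* Dimensions are not part of the type real mat; transpose_mat M = M forces M to be square. *)
definition symmetric_mat :: "real mat \<Rightarrow> bool" where
  "symmetric_mat M \<longleftrightarrow> transpose_mat M = M"

definition spd_mat :: "real mat \<Rightarrow> bool" where
  "spd_mat M \<longleftrightarrow> symmetric_mat M \<and>
     (\<forall>v \<in> carrier_vec (dim_row M). v \<noteq> 0\<^sub>v (dim_row M) \<longrightarrow> v \<bullet> (M *\<^sub>v v) > 0)"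

definition sqrt_mat :: "real mat \<Rightarrow> real mat" where
  "sqrt_mat M = (THE R. R \<in> carrier_mat (dim_row M) (dim_row M) \<and> spd_mat R \<and> R * R = M)"

definition inverse_mat :: "real mat \<Rightarrow> real mat" where
  "inverse_mat M =
     (THE N. N \<in> carrier_mat (dim_row M) (dim_row M) \<and> inverts_mat M N \<and> inverts_mat N M)"

definition inv_sqrt_mat :: "real mat \<Rightarrow> real mat" where
  "inv_sqrt_mat M = inverse_mat (sqrt_mat M)"

end

theory Submission
  imports Defs
begin

text \<open>When both diffusion constants agree, each \<open>B\<close> is a symmetric Toeplitz matrix, and its \<open>\<tau>\<close> matrix
  is \<open>B - H\<close> for an explicit Hankel matrix \<open>H\<close>. The entries of \<open>B\<close> off the diagonal are nonpositive and
  essentially increasing, and the coefficients \<open>q\<close> have telescoping positive partial sums, so that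
  \<open>B + H = 2 B - \<tau>\<close> and \<open>B - 3 H = 3 \<tau> - 2 B\<close> are strictly diagonally dominant and hence positive
  definite. The Kronecker construction is affine in its three matrix arguments and preserves positive
  definiteness, because \<open>A\<^sub>n\<close> is diagonalized by the sine matrix; thus \<open>2 A - P\<close> and \<open>3 P - 2 A\<close> are
  positive definite, which is the claim after congruence by \<open>P\<close> to the power \<open>-1/2\<close>. All summands of \<open>P\<close>
  are diagonalized by one Kronecker product of sine matrices, which yields the square root explicitly.\<close>

section \<open>Finite differences of powers and the coefficients of the scheme\<close>

text \<open>Where 1/2 and 3/2 come from: with \<open>tau = B - H\<close>, the matrix
  \<open>B - mu tau\<close> equals \<open>(1 - mu) (B + c H)\<close> for
  \<open>c = mu / (1 - mu)\<close>. The values \<open>mu = 1/2\<close> and \<open>mu = 3/2\<close>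
  give \<open>c = 1\<close> and \<open>c = -3\<close>, the two ends of the range of \<open>c\<close>
  covered by a single diagonal dominance argument; \<open>c = -1\<close> is \<open>tau\<close>
  itself and makes the preconditioner definite. The obstacle is the coefficient next to the
  diagonal, where the Hessenberg entry \<open>q_0\<close> meets \<open>q_2\<close>. These involve
  \<open>s_0\<close> and \<open>s_1\<close>, which lack terms of a second difference, so the mean
  value argument for the later coefficients does not reach them and a concrete inequality between
  powers is needed. Each Hankel index exceeds the Toeplitz index of the same entry by at least 2, so
  monotonicity is only required across a gap of 2. The inequality therefore compares with
  \<open>q_4\<close>, whose mean value bound is taken at 3/2. The same bound for \<open>q_3\<close>
  would be taken at 1/2 and would be too weak as \<open>d\<close> tends to 1.\<close>

definition fwd_diff :: "(real \<Rightarrow> real) \<Rightarrow> real \<Rightarrow> real" where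
  "fwd_diff f x = f (x + 1) - f x"

lemma fwd_diff_pow_Suc: "(fwd_diff ^^ Suc k) f x = (fwd_diff ^^ k) f (x + 1) - (fwd_diff ^^ k) f x"
  by (simp add: fwd_diff_def)

text \<open>Differentiation commutes with the shift by 1. Shifts only move to the right, so
  differentiability on the positive axis is enough.\<close>

lemma has_real_derivative_fwd_diff_pow:
  assumes "\<And>y. y > 0 \<Longrightarrow> (f has_real_derivative f' y) (at y)" and "x > 0"
  shows "((fwd_diff ^^ k) f has_real_derivative (fwd_diff ^^ k) f' x) (at x)"
  using assms(2)
proof (induction k arbitrary: x)
  case 0
  then show ?case using assms(1) by simp
next
  case (Suc k)
  have "((\<lambda>x. (fwd_diff ^^ k) f (x + 1)) has_real_derivative (fwd_diff ^^ k) f' (x + 1)) (at x)"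
    using Suc.IH[of "x + 1"] Suc.prems by (simp add: DERIV_shift)
  from DERIV_diff[OF this Suc.IH[OF Suc.prems]] show ?case
    unfolding fwd_diff_pow_Suc[abs_def] .
qed

lemma fwd_diff_pow_cmult: "(fwd_diff ^^ k) (\<lambda>x. c * f x) x = c * (fwd_diff ^^ k) f x"
  by (induction k arbitrary: x) (auto simp: fwd_diff_pow_Suc algebra_simps simp del: funpow.simps(2))

text \<open>A \<open>k\<close>-th difference is a \<open>k\<close>-th derivative at an intermediate
  point. Each induction step spends one mean value theorem, which lowers the exponent to
  \<open>p - 1\<close>; hence \<open>p\<close> is generalized. Only \<open>\<xi> \<ge> x\<close> is
  recorded, since the applications need just the sign of the product and the decay of the
  power.\<close>

lemma fwd_diff_pow_powr:
  assumes "x > 0"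
  shows "\<exists>\<xi>\<ge>x. (fwd_diff ^^ k) (\<lambda>x. x powr p) x = (\<Prod>i<k. p - real i) * \<xi> powr (p - real k)"
  using assms
proof (induction k arbitrary: x p)
  case 0
  then show ?case by auto
next
  case (Suc k)
  have "((\<lambda>x. x powr p) has_real_derivative p * y powr (p - 1)) (at y)" if "y > 0" for y
    using that by (rule has_real_derivative_powr)
  then have d: "((fwd_diff ^^ k) (\<lambda>x. x powr p) has_real_derivative
      p * (fwd_diff ^^ k) (\<lambda>x. x powr (p - 1)) y) (at y)" if "y > 0" for y
    using has_real_derivative_fwd_diff_pow[of "\<lambda>x. x powr p" "\<lambda>y. p * y powr (p - 1)" y k] that
    by (simp add: fwd_diff_pow_cmult)
  obtain z where z: "x < z" "z < x + 1"
    "(fwd_diff ^^ k) (\<lambda>x. x powr p) (x + 1) - (fwd_diff ^^ k) (\<lambda>x. x powr p) x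
      = (x + 1 - x) * (p * (fwd_diff ^^ k) (\<lambda>x. x powr (p - 1)) z)"
    using MVT2[of x "x + 1" "(fwd_diff ^^ k) (\<lambda>x. x powr p)"
        "\<lambda>y. p * (fwd_diff ^^ k) (\<lambda>x. x powr (p - 1)) y"] d Suc.prems by auto
  obtain \<xi> where \<xi>: "\<xi> \<ge> z" "(fwd_diff ^^ k) (\<lambda>x. x powr (p - 1)) z
      = (\<Prod>i<k. p - 1 - real i) * \<xi> powr (p - 1 - real k)"
    using Suc.IH[of z "p - 1"] z Suc.prems by auto
  have pr: "(\<Prod>i<Suc k. p - real i) = p * (\<Prod>i<k. p - 1 - real i)"
    by (simp add: prod.lessThan_Suc_shift algebra_simps del: prod.lessThan_Suc)
  show ?case unfolding fwd_diff_pow_Suc z(3) \<xi>(2) pr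
    using z \<xi>(1) by (intro exI[of _ \<xi>]) (auto simp: algebra_simps)
qed

text \<open>The shift by 2 skips \<open>s_0\<close> and \<open>s_1\<close>, which are not full
  second differences. Consequently \<open>q_coeff\<close> is a third difference only from index 3
  on.\<close>

lemma s_coeff_fwd_diff: "s_coeff d (k + 2) = (fwd_diff ^^ 2) (\<lambda>x. x powr d) (real k + 1/2)"
proof -
  have "k + 2 = Suc (Suc k)" by simp
  then show ?thesis unfolding numeral_2_eq_2
    by (simp add: fwd_diff_def algebra_simps)
qed

lemma q_coeff_fwd_diff: "q_coeff d (k + 3) = - (fwd_diff ^^ 3) (\<lambda>x. x powr d) (real k + 1/2)"
proof -
  have "q_coeff d (k + 3) = s_coeff d (k + 2) - s_coeff d (k + 1 + 2)"
    by (simp add: eval_nat_numeral)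
  also have "\<dots> = - (fwd_diff ^^ Suc 2) (\<lambda>x. x powr d) (real k + 1/2)"
    unfolding s_coeff_fwd_diff fwd_diff_pow_Suc by (simp add: add_ac)
  finally show ?thesis by simp
qed

lemma q_coeff_diff: "q_coeff d (k + 3) - q_coeff d (k + 4) = (fwd_diff ^^ 4) (\<lambda>x. x powr d) (real k + 1/2)"
proof -
  have "q_coeff d (k + 3) - q_coeff d (k + 1 + 3) = (fwd_diff ^^ Suc 3) (\<lambda>x. x powr d) (real k + 1/2)"
    unfolding q_coeff_fwd_diff fwd_diff_pow_Suc by (simp add: add_ac)
  then show ?thesis by (simp add: add_ac)
qed

lemma sum_q_coeff: "(\<Sum>k\<le>K. q_coeff d k) = - s_coeff d K"
  by (induction K) auto

context
  fixes d :: real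
  assumes d: "0 < d" "d < 1"
begin

text \<open>Concavity of \<open>x powr d\<close>: the product of the first two factors is
  \<open>d (d - 1) < 0\<close>. By \<open>sum_q_coeff\<close> this makes the partial sums of
  \<open>q_coeff\<close> positive.\<close>

lemma s_coeff_neg: "s_coeff d (k + 2) < 0"
proof -
  obtain \<xi> where "\<xi> \<ge> real k + 1/2"
    "s_coeff d (k + 2) = (\<Prod>i<2. d - real i) * \<xi> powr (d - real 2)"
    using fwd_diff_pow_powr[of "real k + 1/2" 2 d] s_coeff_fwd_diff by auto
  moreover have "(\<Prod>i<2. d - real i) < 0"
    using d by (simp add: numeral_2_eq_2 mult_less_0_iff)
  ultimately show ?thesis by (simp add: mult_less_0_iff)
qed

text \<open>The third derivative of \<open>x powr d\<close> is positive and decreasing, so its value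
  at the left end of the interval bounds the difference. The quantitative half serves only the
  comparison with \<open>q_coeff d 4\<close>.\<close>

lemma q_coeff_bounds:
  "q_coeff d (k + 3) \<le> 0"
  "q_coeff d (k + 3) \<ge> - d * (1 - d) * (2 - d) * (real k + 1/2) powr (d - 3)"
proof -
  obtain \<xi> where \<xi>: "\<xi> \<ge> real k + 1/2"
    "q_coeff d (k + 3) = - ((\<Prod>i<3. d - real i) * \<xi> powr (d - real 3))"
    using fwd_diff_pow_powr[of "real k + 1/2" 3 d] q_coeff_fwd_diff by auto
  have p: "(\<Prod>i<3. d - real i) = d * (1 - d) * (2 - d)"
    by (simp add: numeral_3_eq_3 algebra_simps)
  have c: "d * (1 - d) * (2 - d) \<ge> 0" using d by simp
  then show "q_coeff d (k + 3) \<le> 0" using \<xi> p by simp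
  have "\<xi> powr (d - real 3) \<le> (real k + 1/2) powr (d - 3)"
    using \<xi>(1) d powr_mono2'[of "d - 3" "real k + 1/2" \<xi>] by simp
  from mult_left_mono[OF this c] 
  show "q_coeff d (k + 3) \<ge> - d * (1 - d) * (2 - d) * (real k + 1/2) powr (d - 3)"
    using \<xi>(2) p by simp
qed

text \<open>Consecutive differences are fourth differences of \<open>x powr d\<close>, whose sign is
  that of \<open>d (d - 1) (d - 2) (d - 3) < 0\<close>.\<close>

lemma q_coeff_mono:
  assumes "3 \<le> k" "k \<le> l"
  shows "q_coeff d k \<le> q_coeff d l"
proof -
  have step: "q_coeff d (j + 3) \<le> q_coeff d (j + 4)" for j
  proof -
    obtain \<xi> where "\<xi> \<ge> real j + 1/2"
      "q_coeff d (j + 3) - q_coeff d (j + 4) = (\<Prod>i<4. d - real i) * \<xi> powr (d - real 4)"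
      using fwd_diff_pow_powr[of "real j + 1/2" 4 d] q_coeff_diff by auto
    moreover have "(\<Prod>i<4. d - real i) = - (d * (1 - d) * (2 - d) * (3 - d))"
      by (simp add: numeral_eq_Suc algebra_simps)
    moreover have "d * (1 - d) * (2 - d) * (3 - d) \<ge> 0" using d by simp
    ultimately have "q_coeff d (j + 3) - q_coeff d (j + 4) \<le> 0"
      by (metis mult_nonneg_nonneg mult_minus_left neg_le_0_iff_le powr_ge_zero)
    then show ?thesis by simp
  qed
  have "mono (\<lambda>j. q_coeff d (j + 3))"
    using step by (intro incseq_SucI) (simp add: eval_nat_numeral)
  from monoD[OF this, of "k - 3" "l - 3"] show ?thesis using assms by simp
qed

text \<open>Dividing by \<^term>\<open>3 powr d\<close> makes the left-hand side concave in \<^term>\<open>d\<close>, so that tangents at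
  \<^term>\<open>d = (1::real)\<close>, where it vanishes, suffice. The constant 8/27 is what the bound on
  \<^term>\<open>q_coeff d 4\<close> by the third derivative at 3/2 requires.\<close>

lemma three_term_bound: "3 * 3 powr d - 5 powr d - 4 \<le> - (8/27) * (1 - d) * 3 powr d"
proof -
  let ?e = "1 - d"
  \<comment> \<open>Rational replacements for the tangent slopes: \<open>ln 3\<close> must be
    bounded from below and \<open>ln (5/3)\<close> from above, because the two powers move in
    opposite directions as \<open>d\<close> decreases from 1.\<close>
  have l3: "ln 3 \<ge> (1::real)" using exp_le by (simp add: ln_ge_iff)
  have "1 + 3/5 + (3/5)\<^sup>2/2 \<le> exp (3/5::real)"
    by (rule exp_lower_Taylor_quadratic) simp
  then have "exp (3/5::real) \<ge> 5/3" by (simp add: power2_eq_square)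
  then have l53: "ln (5/3::real) \<le> 3/5" using ln_le_cancel_iff[of "5/3" "exp (3/5::real)"] by simp
  have a: "3 powr (- d) \<ge> 1/3 * (1 + ?e)"
  proof -
    have "3 powr (- d) = 3 powr (-1) * 3 powr ?e"
      by (subst powr_add[symmetric]) simp
    moreover have "1 + ?e * ln 3 \<le> 3 powr ?e"
      using exp_ge_add_one_self[of "?e * ln 3"] by (simp add: powr_def)
    moreover have "?e * ln 3 \<ge> ?e" using l3 d mult_left_mono[of 1 "ln 3" ?e] by simp
    ultimately show ?thesis by (simp add: powr_minus)
  qed
  have b: "(5/3) powr d \<ge> 5/3 * (1 - 3/5 * ?e)"
  proof -
    have eq: "(5/3::real) powr d = 5/3 * (5/3) powr (- ?e)"
      using powr_add[of "5/3" 1 "- ?e"] by simp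
    have "1 - 3/5 * ?e \<le> 1 - ?e * ln (5/3)"
      using l53 d mult_left_mono[of "ln (5/3)" "3/5" ?e] by simp
    also have "\<dots> \<le> (5/3) powr (- ?e)"
      using exp_ge_add_one_self[of "- ?e * ln (5/3)"] unfolding powr_def
      by (simp del: ln_divide_pos minus_diff_eq)
    finally show ?thesis unfolding eq by (rule mult_left_mono) simp
  qed
  \<comment> \<open>The two tangent bounds add up to \<open>- ?e / 3\<close>, and 1/3 = 9/27 leaves
    room over 8/27.\<close>
  have "3 - (5/3) powr d - 4 * 3 powr (- d) \<le> - (8/27) * ?e"
    using a b d by argo
  then have "3 powr d * (3 - (5/3) powr d - 4 * 3 powr (- d)) \<le> 3 powr d * (- (8/27) * ?e)"
    by (intro mult_left_mono) auto
  moreover have "3 powr d * (5/3) powr d = 5 powr d" by (simp flip: powr_mult)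
  moreover have "3 powr d * 3 powr (- d) = 1" by (simp flip: powr_add)
  ultimately show ?thesis by (simp add: algebra_simps)
qed

text \<open>This is the monotonicity of the Toeplitz coefficients from distance 1 to distance 3, the
  one case outside \<open>q_coeff_mono\<close>. The left side is an explicit combination of powers,
  the right side is bounded below by the third derivative at 3/2.\<close>

lemma q_coeff_0_2: "q_coeff d 0 + q_coeff d 2 \<le> q_coeff d 4"
proof -
  have h: "(3/2) powr d = (1/2) powr d * 3 powr d" "(5/2) powr d = (1/2) powr d * 5 powr d"
    by (simp_all flip: powr_mult)
  have "q_coeff d 0 + q_coeff d 2 = (1/2) powr d * (3 * 3 powr d - 5 powr d - 4)"
    by (simp add: numeral_2_eq_2 h algebra_simps)
  also have "\<dots> \<le> (1/2) powr d * (- (8/27) * (1 - d) * 3 powr d)"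
    by (intro mult_left_mono three_term_bound) simp
  also have "\<dots> = - (8/27) * (1 - d) * (3/2) powr d" by (simp add: h)
  \<comment> \<open>The factor \<open>d (2 - d) = 1 - (1 - d)^2\<close> is at most 1, so inserting
    it into a nonpositive quantity only increases that quantity.\<close>
  also have "\<dots> \<le> - (d * (2 - d)) * ((8/27) * (1 - d) * (3/2) powr d)"
  proof -
    have "d * (2 - d) \<le> 1"
      using zero_le_power2[of "d - 1"] by (simp add: power2_eq_square algebra_simps)
    then have "d * (2 - d) * ((8/27) * (1 - d) * (3/2) powr d) \<le> 1 * ((8/27) * (1 - d) * (3/2) powr d)"
      using d by (intro mult_right_mono) auto
    then show ?thesis by simp
  qed
  also have "\<dots> = - d * (1 - d) * (2 - d) * (real 1 + 1/2) powr (d - 3)"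
  proof -
    have "(3/2::real) powr (d - 3) = (3/2) powr d / (3/2) powr 3" by (rule powr_diff)
    also have "(3/2::real) powr 3 = 27/8" by (simp add: power3_eq_cube)
    finally show ?thesis by simp
  qed
  also have "\<dots> \<le> q_coeff d 4" using q_coeff_bounds(2)[of 1] by simp
  finally show ?thesis .
qed

end

section \<open>Symmetric Toeplitz matrices and their sine transforms\<close>

definition toeplitz_mat :: "nat \<Rightarrow> (nat \<Rightarrow> real) \<Rightarrow> real mat" where
  "toeplitz_mat n t = Matrix.mat n n (\<lambda>(i, j). t (if j \<le> i then i - j else j - i))"

text \<open>The Hankel indices run past \<open>n - 1\<close>, while the \<open>tau\<close> matrix
  sees only the first \<open>n\<close> coefficients; the infinite sequence is therefore cut to zero
  from index \<open>n\<close>.\<close>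

definition truncate_at :: "nat \<Rightarrow> (nat \<Rightarrow> real) \<Rightarrow> nat \<Rightarrow> real" where
  "truncate_at n t m = (if m < n then t m else 0)"

text \<open>With indices counted from 1 the two terms are \<open>t_(i+j)\<close> and
  \<open>t_(2(n+1)-i-j)\<close>: the images of a Toeplitz entry under reflection at 0 and at
  \<open>n + 1\<close>.\<close>

definition hankel_mat :: "nat \<Rightarrow> (nat \<Rightarrow> real) \<Rightarrow> real mat" where
  "hankel_mat n t = Matrix.mat n n (\<lambda>(i, j). truncate_at n t (i + j + 2) + truncate_at n t (2 * n - i - j))"

lemma toeplitz_mat_carrier [simp]: "toeplitz_mat n t \<in> carrier_mat n n"
  by (simp add: toeplitz_mat_def)

lemma hankel_mat_carrier [simp]: "hankel_mat n t \<in> carrier_mat n n"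
  by (simp add: hankel_mat_def)

lemma toeplitz_mat_dim [simp]:
  "dim_row (toeplitz_mat n t) = n" "dim_col (toeplitz_mat n t) = n"
  by (simp_all add: toeplitz_mat_def)

lemma hankel_mat_dim [simp]:
  "dim_row (hankel_mat n t) = n" "dim_col (hankel_mat n t) = n"
  by (simp_all add: hankel_mat_def)

lemma sine_mat_carrier [simp]: "sine_mat n \<in> carrier_mat n n"
  by (simp add: sine_mat_def)

lemma sine_mat_dim [simp]: "dim_row (sine_mat n) = n" "dim_col (sine_mat n) = n"
  by (simp_all add: sine_mat_def)

text \<open>Reindexing by the coefficient index \<open>m\<close>, here and in
  \<open>sum_hankel_row\<close>, lets the Toeplitz and Hankel parts be joined term by term.\<close>

lemma sum_toeplitz_row:
  fixes t w :: "nat \<Rightarrow> real"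
  assumes "i < n"
  shows "(\<Sum>j<n. toeplitz_mat n t $$ (i, j) * w j) =
    t 0 * w i + (\<Sum>m=1..<i+1. t m * w (i - m)) + (\<Sum>m=1..<n-i. t m * w (i + m))"
proof -
  have u: "{..<n} = insert i ({..<i} \<union> {i<..<n})" using assms by auto
  have "(\<Sum>j<n. toeplitz_mat n t $$ (i, j) * w j) =
      (\<Sum>j<i. toeplitz_mat n t $$ (i, j) * w j) + toeplitz_mat n t $$ (i, i) * w i
      + (\<Sum>j\<in>{i<..<n}. toeplitz_mat n t $$ (i, j) * w j)"
    unfolding u by (subst sum.insert, simp, simp, subst sum.union_disjoint) auto
  also have "(\<Sum>j<i. toeplitz_mat n t $$ (i, j) * w j) = (\<Sum>m=1..<i+1. t m * w (i - m))"
    by (rule sum.reindex_bij_witness[of _ "\<lambda>m. i - m" "\<lambda>j. i - j"])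
       (use assms in \<open>auto simp: toeplitz_mat_def\<close>)
  also have "(\<Sum>j\<in>{i<..<n}. toeplitz_mat n t $$ (i, j) * w j) = (\<Sum>m=1..<n-i. t m * w (i + m))"
    by (rule sum.reindex_bij_witness[of _ "\<lambda>m. i + m" "\<lambda>j. j - i"])
       (use assms in \<open>auto simp: toeplitz_mat_def\<close>)
  finally show ?thesis using assms by (simp add: toeplitz_mat_def)
qed

lemma sum_hankel_row:
  fixes t w :: "nat \<Rightarrow> real"
  assumes "i < n"
  shows "(\<Sum>j<n. hankel_mat n t $$ (i, j) * w j) =
    (\<Sum>m=i+2..<n. t m * w (m - i - 2)) + (\<Sum>m=n-i+1..<n. t m * w (2 * n - i - m))"
proof -
  have "(\<Sum>j<n. hankel_mat n t $$ (i, j) * w j) =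
      (\<Sum>j<n. truncate_at n t (i + j + 2) * w j) + (\<Sum>j<n. truncate_at n t (2 * n - i - j) * w j)"
    using assms by (simp add: hankel_mat_def algebra_simps sum.distrib)
  also have "(\<Sum>j<n. truncate_at n t (i + j + 2) * w j) = (\<Sum>m=i+2..<n. t m * w (m - i - 2))"
  proof -
    have "(\<Sum>j<n. truncate_at n t (i + j + 2) * w j) = (\<Sum>j | j < n \<and> i + j + 2 < n. t (i + j + 2) * w j)"
      by (rule sum.mono_neutral_cong_right) (auto simp: truncate_at_def)
    also have "\<dots> = (\<Sum>m=i+2..<n. t m * w (m - i - 2))"
      by (rule sum.reindex_bij_witness[of _ "\<lambda>m. m - i - 2" "\<lambda>j. i + j + 2"]) (use assms in auto)
    finally show ?thesis .
  qed
  also have "(\<Sum>j<n. truncate_at n t (2 * n - i - j) * w j) = (\<Sum>m=n-i+1..<n. t m * w (2 * n - i - m))"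
  proof -
    have "(\<Sum>j<n. truncate_at n t (2 * n - i - j) * w j)
        = (\<Sum>j | j < n \<and> 2 * n - i - j < n. t (2 * n - i - j) * w j)"
      by (rule sum.mono_neutral_cong_right) (auto simp: truncate_at_def)
    also have "\<dots> = (\<Sum>m=n-i+1..<n. t m * w (2 * n - i - m))"
      by (rule sum.reindex_bij_witness[of _ "\<lambda>m. 2 * n - i - m" "\<lambda>j. 2 * n - i - j"]) (use assms in auto)
    finally show ?thesis .
  qed
  finally show ?thesis .
qed

text \<open>The part left of the diagonal and the first Hankel sum together run through all
  \<open>m\<close> except \<open>i + 1\<close>; the part to the right and the second Hankel sum run
  through all except \<open>n - i\<close>. An omitted coefficient is nonpositive, so leaving it out
  can only increase the sum.\<close>

lemma row_sum_toeplitz_hankel: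
  fixes t :: "nat \<Rightarrow> real"
  assumes "i < n" and neg: "\<And>m. m \<ge> 1 \<Longrightarrow> t m \<le> 0"
  shows "(\<Sum>j<n. toeplitz_mat n t $$ (i, j) + hankel_mat n t $$ (i, j)) \<ge> t 0 + 2 * (\<Sum>m=1..<n. t m)"
proof -
  have "(\<Sum>m=1..<n. t m) \<le> (\<Sum>m\<in>{1..<i+1} \<union> {i+2..<n}. t m)"
    using assms neg by (intro sum_mono2[of "{1..<n}" "{1..<i+1} \<union> {i+2..<n}" "\<lambda>m. - t m", simplified sum_negf neg_le_iff_le]) auto
  then have 1: "(\<Sum>m=1..<n. t m) \<le> (\<Sum>m=1..<i+1. t m) + (\<Sum>m=i+2..<n. t m)"
    by (subst (asm) sum.union_disjoint) auto
  have "(\<Sum>m=1..<n. t m) \<le> (\<Sum>m\<in>{1..<n-i} \<union> {n-i+1..<n}. t m)"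
    using assms neg by (intro sum_mono2[of "{1..<n}" "{1..<n-i} \<union> {n-i+1..<n}" "\<lambda>m. - t m", simplified sum_negf neg_le_iff_le]) auto
  then have 2: "(\<Sum>m=1..<n. t m) \<le> (\<Sum>m=1..<n-i. t m) + (\<Sum>m=n-i+1..<n. t m)"
    by (subst (asm) sum.union_disjoint) auto
  show ?thesis
    using 1 2 sum_toeplitz_row[OF assms(1), of t "\<lambda>_. 1"] sum_hankel_row[OF assms(1), of t "\<lambda>_. 1"]
    by (simp add: sum.distrib)
qed

text \<open>The Toeplitz minus Hankel structure is the one for which the odd \<^term>\<open>2 * (n + 1)\<close>-periodic
  extension of a sine vector turns the product into a convolution.\<close>

lemma toeplitz_hankel_sine:
  fixes t :: "nat \<Rightarrow> real"
  assumes "i < n" and "sin ((real n + 1) * x) = 0"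
  shows "(\<Sum>j<n. (toeplitz_mat n t $$ (i, j) - hankel_mat n t $$ (i, j)) * sin ((real j + 1) * x)) =
    (t 0 + 2 * (\<Sum>m=1..<n. t m * cos (real m * x))) * sin ((real i + 1) * x)"
proof -
  let ?w = "\<lambda>j::nat. sin ((real j + 1) * x)"
  \<comment> \<open>\<open>G\<close> and \<open>K\<close> are the two halves of the product
    \<open>2 cos sin\<close>. Where the argument of the sine leaves the range of row indices,
    oddness about 0 (for \<open>G\<close>) or about \<open>n + 1\<close> (for \<open>K\<close>)
    turns the terms into Hankel terms with a minus sign.\<close>
  define G where "G m = t m * sin ((real i + 1 - real m) * x)" for m
  define K where "K m = t m * sin ((real i + 1 + real m) * x)" for m
  \<comment> \<open>The omitted index is the reflection point itself, where the sine vanishes: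
    \<open>i + 1\<close> for \<open>G\<close>, \<open>n - i\<close> for \<open>K\<close>.\<close>
  have split: "(\<Sum>m=1..<n. f m) = (\<Sum>m=1..<k. f m) + (\<Sum>m=k+1..<n. f m)"
    if "1 \<le> k" "k \<le> n" "k < n \<Longrightarrow> f k = 0" for f :: "nat \<Rightarrow> real" and k
  proof (cases "k < n")
    case True
    have "(\<Sum>m=1..<n. f m) = (\<Sum>m=1..<k. f m) + (\<Sum>m=k..<n. f m)"
      using that by (simp add: sum.atLeastLessThan_concat)
    then show ?thesis using True that by (simp add: sum.atLeast_Suc_lessThan)
  next
    case False
    then show ?thesis using that by simp
  qed
  have "(\<Sum>m=1..<i+1. G m) = (\<Sum>m=1..<i+1. t m * ?w (i - m))"
    by (intro sum.cong) (auto simp: G_def of_nat_diff algebra_simps)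
  moreover have "(\<Sum>m=i+2..<n. G m) = - (\<Sum>m=i+2..<n. t m * ?w (m - i - 2))"
    unfolding sum_negf[symmetric]
  proof (intro sum.cong refl)
    fix m assume m: "m \<in> {i+2..<n}"
    have "(real i + 1 - real m) * x = - ((real (m - i - 2) + 1) * x)"
      using m by (simp add: of_nat_diff algebra_simps)
    then show "G m = - (t m * ?w (m - i - 2))" unfolding G_def by simp
  qed
  ultimately have G: "(\<Sum>m=1..<n. G m) =
      (\<Sum>m=1..<i+1. t m * ?w (i - m)) - (\<Sum>m=i+2..<n. t m * ?w (m - i - 2))"
    using split[of "i+1" G] assms(1) by (simp add: G_def)
  have odd: "sin ((2 * (real n + 1)) * x - y) = - sin y" for y
  proof -
    have e: "(2 * (real n + 1)) * x = 2 * ((real n + 1) * x)" by simp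
    have "sin (2 * ((real n + 1) * x)) = 0" "cos (2 * ((real n + 1) * x)) = 1"
      using assms(2) by (simp_all add: sin_double cos_double_sin)
    then show ?thesis unfolding e sin_diff by simp
  qed
  have "(\<Sum>m=1..<n-i. K m) = (\<Sum>m=1..<n-i. t m * ?w (i + m))"
    by (intro sum.cong) (auto simp: K_def algebra_simps)
  moreover have "(\<Sum>m=n-i+1..<n. K m) = - (\<Sum>m=n-i+1..<n. t m * ?w (2 * n - i - m))"
    unfolding sum_negf[symmetric]
  proof (intro sum.cong refl)
    fix m assume m: "m \<in> {n-i+1..<n}"
    have "(real i + 1 + real m) * x = 2 * (real n + 1) * x - (real (2 * n - i - m) + 1) * x"
      using m assms(1) by (simp add: of_nat_diff algebra_simps)
    then show "K m = - (t m * ?w (2 * n - i - m))" unfolding K_def by (simp only: odd)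
  qed
  moreover have "K (n - i) = 0" using assms by (simp add: K_def of_nat_diff add_ac)
  ultimately have K: "(\<Sum>m=1..<n. K m) =
      (\<Sum>m=1..<n-i. t m * ?w (i + m)) - (\<Sum>m=n-i+1..<n. t m * ?w (2 * n - i - m))"
    using split[of "n-i" K] assms(1) by simp
  have "2 * (t m * cos (real m * x)) * sin ((real i + 1) * x) = G m + K m" for m
    using sin_diff[of "(real i + 1) * x" "real m * x"] sin_add[of "(real i + 1) * x" "real m * x"]
    unfolding G_def K_def left_diff_distrib[symmetric] distrib_right[symmetric]
    by (simp only:) (simp only: algebra_simps)
  then have "(t 0 + 2 * (\<Sum>m=1..<n. t m * cos (real m * x))) * sin ((real i + 1) * x) =
      t 0 * ?w i + (\<Sum>m=1..<n. G m) + (\<Sum>m=1..<n. K m)"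
    by (simp add: distrib_right sum_distrib_left sum_distrib_right sum.distrib[symmetric])
  then show ?thesis
    unfolding G K left_diff_distrib sum_subtractf sum_toeplitz_row[OF assms(1)] sum_hankel_row[OF assms(1)]
    by simp
qed

section \<open>Orthogonality of the sine matrix and diagonalization of \<open>tau\<close>
  matrices\<close>

text \<open>Multiplying by \<open>2 sin (x / 2)\<close> telescopes the sum, and the bound on
  \<open>m\<close> keeps that factor positive. The value depends only on the parity of
  \<open>m\<close>.\<close>

lemma sum_cos_multiples:
  assumes "0 < m" "m < 2 * (n + 1)"
  shows "(\<Sum>k<n. cos (real (k + 1) * (real m * pi / (real n + 1)))) = (- 1 - (- 1) ^ m) / 2"
proof -
  define x where "x = real m * pi / (real n + 1)"
  have "real m < real (2 * (n + 1))" using assms by (simp only: of_nat_less_iff)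
  then have "real m < 2 * (real n + 1)" by simp
  then have "x / 2 < pi" by (simp add: x_def pos_divide_less_eq)
  moreover have "x / 2 > 0" using assms by (simp add: x_def)
  ultimately have s: "sin (x / 2) > 0" by (simp add: sin_gt_zero)
  have telescope: "2 * sin (x / 2) * (\<Sum>k<N. cos (real (k + 1) * x)) = sin ((real N + 1/2) * x) - sin (x / 2)" for N
  proof (induction N)
    case 0
    then show ?case by simp
  next
    case (Suc N)
    have "2 * sin (x / 2) * cos (real (N + 1) * x) = sin ((real N + 1 + 1/2) * x) - sin ((real N + 1/2) * x)"
      using sin_times_cos[of "x/2" "real (N + 1) * x"] sin_minus[of "(real N + 1/2) * x"]
      by (simp add: algebra_simps)
    then show ?case using Suc.IH by (simp add: algebra_simps)
  qed
  have "sin ((real n + 1/2) * x) = - ((- 1) ^ m * sin (x / 2))"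
  proof -
    have "(real n + 1/2) * x = real m * pi - x / 2"
      by (simp add: x_def field_simps)
    then show ?thesis by (simp add: sin_diff cos_npi)
  qed
  then have "2 * sin (x / 2) * (\<Sum>k<n. cos (real (k + 1) * x)) = sin (x / 2) * (- 1 - (- 1) ^ m)"
    unfolding telescope by (simp add: right_diff_distrib)
  then have "sin (x / 2) * (2 * (\<Sum>k<n. cos (real (k + 1) * x))) = sin (x / 2) * (- 1 - (- 1) ^ m)"
    by (simp only: mult_ac)
  then have "2 * (\<Sum>k<n. cos (real (k + 1) * x)) = - 1 - (- 1) ^ m"
    using mult_left_cancel[of "sin (x / 2)"] s by (metis less_irrefl)
  then show ?thesis unfolding x_def[symmetric] by simp
qed

text \<open>An entry is a difference of cosine sums at \<open>|i - j|\<close> and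
  \<open>i + j + 2\<close>. These have equal parity, so the sums cancel off the diagonal. On the
  diagonal they are \<open>n\<close> and \<open>-1\<close>, and their difference cancels the
  normalization.\<close>

lemma sine_mat_involution: "sine_mat n * sine_mat n = 1\<^sub>m n"
proof (rule eq_matI)
  fix i j assume "i < dim_row (1\<^sub>m n :: real mat)" "j < dim_col (1\<^sub>m n :: real mat)"
  then have ij: "i < n" "j < n" by auto
  define C where "C m = (\<Sum>k<n. cos (real (k + 1) * (real m * pi / (real n + 1))))" for m :: nat
  define m where "m = (if j \<le> i then i - j else j - i)"
  have cosm: "cos (real (k + 1) * ((real i - real j) * pi / (real n + 1)))
      = cos (real (k + 1) * (real m * pi / (real n + 1)))" for k
  proof (cases "j \<le> i")
    case True then show ?thesis by (simp add: m_def of_nat_diff)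
  next
    case False
    then have "real (k + 1) * ((real i - real j) * pi / (real n + 1))
        = - (real (k + 1) * (real m * pi / (real n + 1)))"
      by (simp add: m_def of_nat_diff field_simps)
    then show ?thesis by simp
  qed
  have "(sine_mat n * sine_mat n) $$ (i, j) =
    (\<Sum>k<n. (sqrt (2 / (real n + 1)) * sin (real (i + 1) * real (k + 1) * pi / (real n + 1))) *
       (sqrt (2 / (real n + 1)) * sin (real (k + 1) * real (j + 1) * pi / (real n + 1))))"
    using ij by (simp add: scalar_prod_def sine_mat_def atLeast0LessThan)
  also have "\<dots> = (\<Sum>k<n. (1 / (real n + 1)) *
     (cos (real (k + 1) * (real m * pi / (real n + 1))) -
      cos (real (k + 1) * (real (i + j + 2) * pi / (real n + 1)))))"
  proof (intro sum.cong refl)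
    fix k
    let ?c = "sqrt (2 / (real n + 1))"
    let ?a = "real (i + 1) * real (k + 1) * pi / (real n + 1)"
    let ?b = "real (k + 1) * real (j + 1) * pi / (real n + 1)"
    have half: "2 / N * (z / 2) = 1 / N * z" for N z :: real by simp
    have "?c * sin ?a * (?c * sin ?b) = (?c * ?c) * (sin ?a * sin ?b)"
      by (simp only: mult_ac)
    also have "?c * ?c = 2 / (real n + 1)" by simp
    also have "sin ?a * sin ?b = (cos (?a - ?b) - cos (?a + ?b)) / 2" by (rule sin_times_sin)
    also have "?a - ?b = real (k + 1) * ((real i - real j) * pi / (real n + 1))"
      unfolding diff_divide_distrib[symmetric] times_divide_eq_right by (simp add: algebra_simps)
    also have "?a + ?b = real (k + 1) * (real (i + j + 2) * pi / (real n + 1))"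
      unfolding add_divide_distrib[symmetric] times_divide_eq_right by (simp add: algebra_simps)
    finally show "?c * sin ?a * (?c * sin ?b) = (1 / (real n + 1)) *
     (cos (real (k + 1) * (real m * pi / (real n + 1))) -
      cos (real (k + 1) * (real (i + j + 2) * pi / (real n + 1))))"
      unfolding cosm by (simp only: half)
  qed
  also have "\<dots> = (C m - C (i + j + 2)) / (real n + 1)"
    unfolding C_def sum_distrib_left[symmetric] sum_subtractf by simp
  also have "\<dots> = (if i = j then 1 else 0)"
  proof -
    have C2: "C (i + j + 2) = (- 1 - (- 1) ^ (i + j)) / 2"
      unfolding C_def using ij by (subst sum_cos_multiples) auto
    show ?thesis
    proof (cases "i = j")
      case True
      then have "C m = real n" by (simp add: C_def m_def)
      moreover have "C (i + j + 2) = - 1" using C2 True by simp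
      ultimately show ?thesis using True by simp
    next
      case False
      then have "C m = (- 1 - (- 1) ^ m) / 2"
        unfolding C_def using ij by (subst sum_cos_multiples) (auto simp: m_def)
      moreover have "(- 1::real) ^ m = (- 1) ^ (i + j)"
        by (auto simp: m_def minus_one_power_iff)
      ultimately show ?thesis using C2 False by simp
    qed
  qed
  finally show "(sine_mat n * sine_mat n) $$ (i, j) = 1\<^sub>m n $$ (i, j)" using ij by simp
qed auto

definition tau_eigenvalue :: "nat \<Rightarrow> (nat \<Rightarrow> real) \<Rightarrow> nat \<Rightarrow> real" where
  "tau_eigenvalue n t k = t 0 + 2 * (\<Sum>m=1..<n. t m * cos (real m * (real (k + 1) * pi / (real n + 1))))"

lemma tau_mat_toeplitz_sine:
  assumes "n > 0"
  shows "tau_mat (toeplitz_mat n t) = sine_mat n * mat_diag n (tau_eigenvalue n t) * sine_mat n"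
proof -
  have "{1..n - 1} = {1..<n}" using assms by auto
  then have "mat_diag n (\<lambda>k. toeplitz_mat n t $$ (0, 0) + 2 * (\<Sum>j = 1..n - 1. toeplitz_mat n t $$ (j, 0) *
      cos (real j * real (k + 1) * pi / (real n + 1)))) = mat_diag n (tau_eigenvalue n t)"
    using assms by (auto simp: tau_eigenvalue_def toeplitz_mat_def mat_diag_def intro!: eq_matI sum.cong arg_cong[where f = cos])
  then show ?thesis by (simp add: tau_mat_def Let_def)
qed

text \<open>By \<open>toeplitz_hankel_sine\<close> the columns of the sine matrix are eigenvectors
  of the right-hand side with the \<open>tau\<close> eigenvalues; the sine matrix is its own
  inverse, which finishes the comparison.\<close>

lemma tau_mat_toeplitz:
  assumes "n > 0"
  shows "tau_mat (toeplitz_mat n t) = toeplitz_mat n t - hankel_mat n t"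
proof -
  let ?S = "sine_mat n" and ?M = "toeplitz_mat n t - hankel_mat n t"
  have M: "?M \<in> carrier_mat n n" by (simp add: minus_carrier_mat)
  have "?M * ?S = ?S * mat_diag n (tau_eigenvalue n t)"
  proof (rule eq_matI)
    fix i k assume "i < dim_row (?S * mat_diag n (tau_eigenvalue n t))"
      "k < dim_col (?S * mat_diag n (tau_eigenvalue n t))"
    then have ik: "i < n" "k < n" by (auto simp: mat_diag_def)
    let ?x = "real (k + 1) * pi / (real n + 1)"
    have s0: "sin ((real n + 1) * ?x) = 0" 
      using sin_npi[of "k + 1"] by simp
    have "(?M * ?S) $$ (i, k) = (\<Sum>j<n. (toeplitz_mat n t $$ (i, j) - hankel_mat n t $$ (i, j)) *
        (sqrt (2 / (real n + 1)) * sin ((real j + 1) * ?x)))"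
      using ik by (simp add: scalar_prod_def sine_mat_def atLeast0LessThan add_ac mult_ac)
    also have "\<dots> = sqrt (2 / (real n + 1)) * (\<Sum>j<n. (toeplitz_mat n t $$ (i, j) - hankel_mat n t $$ (i, j)) * sin ((real j + 1) * ?x))"
      by (simp add: sum_distrib_left mult_ac)
    also have "\<dots> = sqrt (2 / (real n + 1)) * (tau_eigenvalue n t k * sin ((real i + 1) * ?x))"
      unfolding toeplitz_hankel_sine[OF ik(1) s0] tau_eigenvalue_def ..
    also have "\<dots> = (?S * mat_diag n (tau_eigenvalue n t)) $$ (i, k)"
      using ik by (subst mat_diag_mult_right[of _ n]) (auto simp: sine_mat_def add_ac mult_ac)
    finally show "(?M * ?S) $$ (i, k) = (?S * mat_diag n (tau_eigenvalue n t)) $$ (i, k)" .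
  qed (auto simp: mat_diag_def)
  then have "tau_mat (toeplitz_mat n t) = ?M * ?S * ?S"
    using tau_mat_toeplitz_sine[OF assms, of t] by simp
  also have "\<dots> = ?M * (?S * ?S)"
    using M by (intro assoc_mult_mat[of _ n n _ n _ n]) auto
  finally show ?thesis using M by (simp add: sine_mat_involution)
qed

section \<open>Symmetric positive definite matrices\<close>

lemma quadratic_form_eq_sum:
  assumes "M \<in> carrier_mat n n" "v \<in> carrier_vec n"
  shows "v \<bullet> (M *\<^sub>v v) = (\<Sum>i<n. \<Sum>j<n. M $$ (i, j) * v $ i * (v $ j :: real))"
  using assms by (auto simp: scalar_prod_def atLeast0LessThan sum_distrib_left mult_ac intro!: sum.cong)

lemma spd_matI:
  assumes "M \<in> carrier_mat n n" "symmetric_mat M"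
    "\<And>v. v \<in> carrier_vec n \<Longrightarrow> v \<noteq> 0\<^sub>v n \<Longrightarrow> v \<bullet> (M *\<^sub>v v) > 0"
  shows "spd_mat M"
  using assms unfolding spd_mat_def by auto

lemma spd_matD:
  assumes "spd_mat M" "M \<in> carrier_mat n n"
  shows "transpose_mat M = M"
    and "v \<in> carrier_vec n \<Longrightarrow> v \<noteq> 0\<^sub>v n \<Longrightarrow> v \<bullet> (M *\<^sub>v v) > 0"
    and "v \<in> carrier_vec n \<Longrightarrow> v \<bullet> (M *\<^sub>v v) \<ge> 0"
proof -
  show s: "transpose_mat M = M" and p: "v \<in> carrier_vec n \<Longrightarrow> v \<noteq> 0\<^sub>v n \<Longrightarrow> v \<bullet> (M *\<^sub>v v) > 0"
    using assms unfolding spd_mat_def symmetric_mat_def by auto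
  show "v \<in> carrier_vec n \<Longrightarrow> v \<bullet> (M *\<^sub>v v) \<ge> 0"
    using p assms(2) by (cases "v = 0\<^sub>v n") auto
qed

lemma spd_mat_diag_dominant:
  assumes M: "M \<in> carrier_mat n n" and sym: "symmetric_mat M"
    and dom: "\<And>i. i < n \<Longrightarrow> (\<Sum>j\<in>{..<n}-{i}. \<bar>M $$ (i, j)\<bar>) < M $$ (i, i)"
  shows "spd_mat M"
proof (rule spd_matI[OF M sym])
  fix v :: "real Matrix.vec" assume v: "v \<in> carrier_vec n" "v \<noteq> 0\<^sub>v n"
  have Mt: "M $$ (j, i) = M $$ (i, j)" if "i < n" "j < n" for i j
    using arg_cong[OF sym[unfolded symmetric_mat_def], of "\<lambda>X. X $$ (i, j)"] that M by simp
  define r where "r i = (\<Sum>j\<in>{..<n}-{i}. \<bar>M $$ (i, j)\<bar>)" for i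
  let ?a = "\<lambda>i j. if i = j then 0 else \<bar>M $$ (i, j)\<bar>"
  have r: "r i = (\<Sum>j<n. ?a i j)" if "i < n" for i
    unfolding r_def by (rule sum.mono_neutral_cong_left) auto
  have "(\<Sum>i<n. (M $$ (i, i) - r i) * (v $ i)\<^sup>2) =
     (\<Sum>i<n. M $$ (i, i) * (v $ i)\<^sup>2) - (\<Sum>i<n. \<Sum>j<n. ?a i j * (v $ i)\<^sup>2)"
    by (simp add: left_diff_distrib sum_subtractf r sum_distrib_right)
  \<comment> \<open>Symmetry spreads the row radii evenly over both coordinates, so that each pair
    can be handled by \<open>2 |x y| <= x^2 + y^2\<close>.\<close>
  also have "(\<Sum>i<n. \<Sum>j<n. ?a i j * (v $ i)\<^sup>2) =
      (\<Sum>i<n. \<Sum>j<n. ?a i j * ((v $ i)\<^sup>2 + (v $ j)\<^sup>2) / 2)"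
  proof -
    have "(\<Sum>i<n. \<Sum>j<n. ?a i j * (v $ j)\<^sup>2) = (\<Sum>i<n. \<Sum>j<n. ?a i j * (v $ i)\<^sup>2)"
      by (subst sum.swap) (auto intro!: sum.cong simp: Mt)
    moreover have "(\<Sum>i<n. \<Sum>j<n. ?a i j * ((v $ i)\<^sup>2 + (v $ j)\<^sup>2) / 2) =
      ((\<Sum>i<n. \<Sum>j<n. ?a i j * (v $ i)\<^sup>2) + (\<Sum>i<n. \<Sum>j<n. ?a i j * (v $ j)\<^sup>2)) / 2"
      unfolding sum.distrib[symmetric] sum_divide_distrib distrib_left ..
    ultimately show ?thesis by simp
  qed
  also have "(\<Sum>i<n. M $$ (i, i) * (v $ i)\<^sup>2) = (\<Sum>i<n. \<Sum>j<n. if i = j then M $$ (i, j) * (v $ i)\<^sup>2 else 0)"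
    by simp
  also have "\<dots> - (\<Sum>i<n. \<Sum>j<n. ?a i j * ((v $ i)\<^sup>2 + (v $ j)\<^sup>2) / 2) \<le>
      (\<Sum>i<n. \<Sum>j<n. M $$ (i, j) * v $ i * v $ j)"
    unfolding sum_subtractf[symmetric]
  proof (intro sum_mono)
    fix i j
    have "\<bar>v $ i * v $ j\<bar> \<le> ((v $ i)\<^sup>2 + (v $ j)\<^sup>2) / 2"
      using zero_le_power2[of "\<bar>v $ i\<bar> - \<bar>v $ j\<bar>"] by (simp add: power2_diff abs_mult)
    then have "\<bar>M $$ (i, j)\<bar> * \<bar>v $ i * v $ j\<bar> \<le> \<bar>M $$ (i, j)\<bar> * (((v $ i)\<^sup>2 + (v $ j)\<^sup>2) / 2)"
      by (rule mult_left_mono) simp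
    then have "- (M $$ (i, j) * v $ i * v $ j) \<le> \<bar>M $$ (i, j)\<bar> * ((v $ i)\<^sup>2 + (v $ j)\<^sup>2) / 2"
      unfolding abs_mult[symmetric] by (simp add: mult.assoc)
    then show "(if i = j then M $$ (i, j) * (v $ i)\<^sup>2 else 0) - ?a i j * ((v $ i)\<^sup>2 + (v $ j)\<^sup>2) / 2
        \<le> M $$ (i, j) * v $ i * v $ j"
      by (auto simp: power2_eq_square)
  qed
  also have "\<dots> = v \<bullet> (M *\<^sub>v v)" using quadratic_form_eq_sum[OF M v(1)] by simp
  finally have "(\<Sum>i<n. (M $$ (i, i) - r i) * (v $ i)\<^sup>2) \<le> v \<bullet> (M *\<^sub>v v)" .
  moreover obtain k where "k < n" "v $ k \<noteq> 0"
    using v by (metis carrier_vecD eq_vecI index_zero_vec)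
  then have "(\<Sum>i<n. (M $$ (i, i) - r i) * (v $ i)\<^sup>2) > 0"
    using dom by (intro sum_pos2[of _ k]) (auto simp: r_def less_imp_le)
  ultimately show "v \<bullet> (M *\<^sub>v v) > 0" by linarith
qed

lemma spd_mat_add:
  assumes "spd_mat X" "spd_mat Y" "X \<in> carrier_mat n n" "Y \<in> carrier_mat n n"
  shows "spd_mat (X + Y)"
proof (rule spd_matI[of _ n])
  show "symmetric_mat (X + Y)"
    using assms spd_matD(1) transpose_add unfolding symmetric_mat_def by metis
  fix v :: "real Matrix.vec" assume v: "v \<in> carrier_vec n" "v \<noteq> 0\<^sub>v n"
  have "v \<bullet> ((X + Y) *\<^sub>v v) = v \<bullet> (X *\<^sub>v v) + v \<bullet> (Y *\<^sub>v v)"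
    using assms v by (simp add: add_mult_distrib_mat_vec[of _ n n] scalar_prod_add_distrib[of _ n])
  then show "v \<bullet> ((X + Y) *\<^sub>v v) > 0"
    using spd_matD(2)[OF assms(1,3) v] spd_matD(2)[OF assms(2,4) v] by simp
qed (use assms in auto)

lemma quadratic_form_smult:
  assumes "X \<in> carrier_mat n n" "v \<in> carrier_vec n"
  shows "v \<bullet> ((c \<cdot>\<^sub>m X) *\<^sub>v v) = c * (v \<bullet> (X *\<^sub>v v) :: real)"
proof -
  have "c \<cdot>\<^sub>m X \<in> carrier_mat n n" using assms by simp
  then show ?thesis using assms
    by (subst (1 2) quadratic_form_eq_sum) (auto simp: sum_distrib_left mult_ac intro!: sum.cong)
qed

lemma transpose_smult_mat: "transpose_mat (c \<cdot>\<^sub>m X) = c \<cdot>\<^sub>m transpose_mat X"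
  by (rule eq_matI) auto

lemma spd_mat_smult:
  assumes "spd_mat X" "X \<in> carrier_mat n n" "c > 0"
  shows "spd_mat (c \<cdot>\<^sub>m X)"
proof (rule spd_matI[of _ n])
  show "symmetric_mat (c \<cdot>\<^sub>m X)"
    using spd_matD(1)[OF assms(1,2)] unfolding symmetric_mat_def by (simp add: transpose_smult_mat)
qed (use assms spd_matD(2)[OF assms(1,2)] in \<open>auto simp: quadratic_form_smult\<close>)

text \<open>The left inverse \<open>L\<close> makes \<open>R\<close> injective; every application
  takes a symmetric involution for both.\<close>

lemma spd_mat_congruence:
  assumes M: "spd_mat M" "M \<in> carrier_mat n n"
    and R: "R \<in> carrier_mat n n" and L: "L \<in> carrier_mat n n" and LR: "L * R = 1\<^sub>m n"
  shows "spd_mat (transpose_mat R * M * R)"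
proof (rule spd_matI[of _ n])
  show "symmetric_mat (transpose_mat R * M * R)"
    using M R spd_matD(1)[OF M] unfolding symmetric_mat_def
    by (simp add: transpose_mult[of _ n n _ n] assoc_mult_mat[of _ n n _ n _ n] mult_carrier_mat[of _ n n _ n])
  fix v :: "real Matrix.vec" assume v: "v \<in> carrier_vec n" "v \<noteq> 0\<^sub>v n"
  have "L *\<^sub>v (R *\<^sub>v v) = v" using v L R LR by (simp flip: assoc_mult_mat_vec[of _ n n _ n])
  moreover have "L *\<^sub>v 0\<^sub>v n = 0\<^sub>v n" using L by (intro eq_vecI) auto
  ultimately have "R *\<^sub>v v \<noteq> 0\<^sub>v n" using v(2) by metis
  moreover have Rv: "R *\<^sub>v v \<in> carrier_vec n" using R v by simp
  ultimately have "(R *\<^sub>v v) \<bullet> (M *\<^sub>v (R *\<^sub>v v)) > 0" using spd_matD(2)[OF M] by simp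
  also have "(R *\<^sub>v v) \<bullet> (M *\<^sub>v (R *\<^sub>v v)) = v \<bullet> (transpose_mat R *\<^sub>v (M *\<^sub>v (R *\<^sub>v v)))"
    using transpose_vec_mult_scalar[of "transpose_mat R" n n "M *\<^sub>v (R *\<^sub>v v)" v] M R v by simp
  also have "\<dots> = v \<bullet> ((transpose_mat R * M * R) *\<^sub>v v)"
    using M R v by (simp add: assoc_mult_mat_vec[of _ n n _ n])
  finally show "v \<bullet> ((transpose_mat R * M * R) *\<^sub>v v) > 0" .
qed (use M R in auto)

text \<open>The difference \<^term>\<open>D = R - S\<close> solves the Sylvester equation \<open>R D + D S = 0\<close>, whose trace
  inner product with \<^term>\<open>D\<close> is a sum of two nonnegative quadratic forms.\<close>

lemma spd_sqrt_unique:
  assumes R: "spd_mat R" "R \<in> carrier_mat n n" and S: "spd_mat S" "S \<in> carrier_mat n n"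
    and eq: "R * R = S * S"
  shows "R = S"
proof -
  define D where "D = R - S"
  have D: "D \<in> carrier_mat n n" using R S by (simp add: D_def minus_carrier_mat)
  have "R * D + D * S = (R * R - R * S) + (R * S - S * S)"
    using R S unfolding D_def
    by (simp add: mult_minus_distrib_mat[of _ n n _ n] minus_mult_distrib_mat[of _ n n _ _ n])
  then have z: "R * D + D * S = 0\<^sub>m n n" using R S eq by auto
  \<comment> \<open>The sum over columns is the trace of \<open>D^T R D\<close>, the later sum over
    rows that of \<open>D S D^T\<close>. Both become entrywise products with \<open>D\<close>, so
    they add up to the product with \<open>R * D + D * S\<close>.\<close>
  have "(\<Sum>j<n. col D j \<bullet> (R *\<^sub>v col D j)) = (\<Sum>i<n. \<Sum>j<n. D $$ (i, j) * (R * D) $$ (i, j))"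
    by (subst sum.swap) (use D R in \<open>auto simp: scalar_prod_def atLeast0LessThan intro!: sum.cong\<close>)
  moreover have "(\<Sum>i<n. row D i \<bullet> (S *\<^sub>v row D i)) = (\<Sum>i<n. \<Sum>j<n. D $$ (i, j) * (D * S) $$ (i, j))"
  proof (intro sum.cong refl)
    fix i assume i: "i \<in> {..<n}"
    have Sij: "S $$ (j, k) = S $$ (k, j)" if "j < n" "k < n" for j k
      using arg_cong[OF spd_matD(1)[OF S], of "\<lambda>X. X $$ (k, j)"] that S by simp
    show "row D i \<bullet> (S *\<^sub>v row D i) = (\<Sum>j<n. D $$ (i, j) * (D * S) $$ (i, j))"
      using i D S by (auto simp: scalar_prod_def atLeast0LessThan Sij mult_ac intro!: sum.cong)
  qed
  moreover have "(\<Sum>i<n. \<Sum>j<n. D $$ (i, j) * (R * D) $$ (i, j)) +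
      (\<Sum>i<n. \<Sum>j<n. D $$ (i, j) * (D * S) $$ (i, j)) = (\<Sum>i<n. \<Sum>j<n. D $$ (i, j) * (R * D + D * S) $$ (i, j))"
    using D R S by (simp add: sum.distrib distrib_left)
  moreover have "\<dots> = 0" unfolding z by simp
  ultimately have "(\<Sum>j<n. col D j \<bullet> (R *\<^sub>v col D j)) + (\<Sum>i<n. row D i \<bullet> (S *\<^sub>v row D i)) = 0" by simp
  moreover have "(\<Sum>j<n. col D j \<bullet> (R *\<^sub>v col D j)) \<ge> 0"
    using D by (intro sum_nonneg spd_matD(3)[OF R]) auto
  moreover have nn: "row D i \<bullet> (S *\<^sub>v row D i) \<ge> 0" if "i < n" for i
    using D that by (intro spd_matD(3)[OF S]) auto
  then have "(\<Sum>i<n. row D i \<bullet> (S *\<^sub>v row D i)) \<ge> 0" by (auto intro: sum_nonneg)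
  ultimately have "(\<Sum>i<n. row D i \<bullet> (S *\<^sub>v row D i)) = 0" by linarith
  then have "row D i \<bullet> (S *\<^sub>v row D i) = 0" if "i < n" for i
    using nn that by (subst (asm) sum_nonneg_eq_0_iff) auto
  then have row0: "row D i = 0\<^sub>v n" if "i < n" for i
    using spd_matD(2)[OF S, of "row D i"] that D by fastforce
  show ?thesis
  proof (rule eq_matI)
    fix i j assume "i < dim_row S" "j < dim_col S"
    then have ij: "i < n" "j < n" using S by auto
    have "D $$ (i, j) = 0" using arg_cong[OF row0[OF ij(1)], of "\<lambda>v. v $ j"] ij D by simp
    then show "R $$ (i, j) = S $$ (i, j)" using ij R S by (simp add: D_def)
  qed (use R S in auto)
qed

section \<open>Simultaneous diagonalization and the inverse square root\<close>

text \<open>Fixing the eigenbasis \<open>U\<close> as an argument makes the class closed under sums.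
  A symmetric involution is its own transpose and inverse, and Kronecker products preserve
  this.\<close>

definition orthogonally_pd :: "nat \<Rightarrow> real mat \<Rightarrow> real mat \<Rightarrow> bool" where
  "orthogonally_pd n U X \<longleftrightarrow> U \<in> carrier_mat n n \<and> transpose_mat U = U \<and> U * U = 1\<^sub>m n \<and>
     (\<exists>e. (\<forall>k<n. e k > 0) \<and> X = U * mat_diag n e * U)"

lemma transpose_mat_diag: "transpose_mat (mat_diag n e) = mat_diag n e"
  by (auto simp: mat_diag_def)

lemma mat_diag_dims [simp]: "dim_row (mat_diag n e) = n" "dim_col (mat_diag n e) = n"
  by (simp_all add: mat_diag_def)

lemma spd_mat_diag:
  assumes "\<And>k. k < n \<Longrightarrow> e k > 0"
  shows "spd_mat (mat_diag n e)"
proof (rule spd_mat_diag_dominant[of _ n])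
  show "symmetric_mat (mat_diag n e)" by (simp add: symmetric_mat_def transpose_mat_diag)
  fix i assume "i < n"
  then show "(\<Sum>j\<in>{..<n}-{i}. \<bar>mat_diag n e $$ (i, j)\<bar>) < mat_diag n e $$ (i, i)"
    using assms by (subst sum.neutral) (auto simp: mat_diag_def)
qed auto

lemma orthogonally_pd_carrier: "orthogonally_pd n U X \<Longrightarrow> X \<in> carrier_mat n n"
  by (auto simp: orthogonally_pd_def)

lemma orthogonally_pd_imp_spd:
  assumes "orthogonally_pd n U X"
  shows "spd_mat X"
proof -
  from assms obtain e where U: "U \<in> carrier_mat n n" "transpose_mat U = U" "U * U = 1\<^sub>m n"
    and e: "\<And>k. k < n \<Longrightarrow> e k > 0" "X = U * mat_diag n e * U"
    unfolding orthogonally_pd_def by auto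
  show ?thesis
    using spd_mat_congruence[OF spd_mat_diag[OF e(1)] mat_diag_dim U(1) U(1) U(3)] e(2) U(2) by simp
qed

lemma conjugate_mult:
  assumes "U \<in> carrier_mat n n" "U * U = 1\<^sub>m n" "D \<in> carrier_mat n n" "E \<in> carrier_mat n n"
  shows "(U * D * U) * (U * E * U) = U * (D * E) * (U :: real mat)"
proof -
  have "(U * D * U) * (U * E * U) = U * D * (U * U) * (E * U)"
    using assms(1,3,4) by (simp add: assoc_mult_mat[of _ n n _ n _ n] mult_carrier_mat[of _ n n _ n])
  then show ?thesis using assms by (simp add: assoc_mult_mat[of _ n n _ n _ n] mult_carrier_mat[of _ n n _ n])
qed

text \<open>Reads positivity of the eigenvalues off definiteness by testing unit vectors. The
  eigenvalues of the \<open>tau\<close> matrix are handled this way: they are cosine sums that are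
  never estimated directly.\<close>

lemma orthogonally_pdI:
  assumes U: "U \<in> carrier_mat n n" "transpose_mat U = U" "U * U = 1\<^sub>m n"
    and spd: "spd_mat (U * mat_diag n e * U)"
  shows "orthogonally_pd n U (U * mat_diag n e * U)"
proof -
  let ?X = "U * mat_diag n e * U"
  have X: "?X \<in> carrier_mat n n" using U(1) by (simp add: mult_carrier_mat[of _ n n _ n])
  have "transpose_mat U * ?X * U = (U * U) * mat_diag n e * (U * U)"
    using U(1) by (simp only: U(2)) (simp add: assoc_mult_mat[of _ n n _ n _ n] mult_carrier_mat[of _ n n _ n])
  also have "\<dots> = mat_diag n e" using U(3) by simp
  finally have D: "spd_mat (mat_diag n e)"
    using spd_mat_congruence[OF spd X U(1) U(1) U(3)] by simp
  have "e k > 0" if k: "k < n" for k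
  proof -
    have u: "unit_vec n k \<in> carrier_vec n" "unit_vec n k \<noteq> (0\<^sub>v n :: real Matrix.vec)"
      using k by auto
    have "unit_vec n k \<bullet> (mat_diag n e *\<^sub>v unit_vec n k) = e k"
      using k by (subst scalar_prod_left_unit[OF mult_mat_vec_carrier[OF mat_diag_dim unit_vec_carrier]])
        (auto simp: mat_diag_def)
    then show ?thesis using spd_matD(2)[OF D mat_diag_dim u] by simp
  qed
  then show ?thesis using U unfolding orthogonally_pd_def by blast
qed

lemma orthogonally_pd_add:
  assumes "orthogonally_pd n U X" "orthogonally_pd n U Y"
  shows "orthogonally_pd n U (X + Y)"
proof -
  from assms obtain e f where U: "U \<in> carrier_mat n n" "transpose_mat U = U" "U * U = 1\<^sub>m n"
    and e: "\<And>k. k < n \<Longrightarrow> e k > 0" "X = U * mat_diag n e * U"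
    and f: "\<And>k. k < n \<Longrightarrow> f k > 0" "Y = U * mat_diag n f * U"
    unfolding orthogonally_pd_def by auto
  have "mat_diag n (\<lambda>k. e k + f k) = mat_diag n e + mat_diag n f"
    by (auto simp: mat_diag_def)
  then have "U * mat_diag n (\<lambda>k. e k + f k) * U = X + Y"
    using U(1) unfolding e(2) f(2)
    by (simp add: mult_add_distrib_mat[of _ n n _ n] add_mult_distrib_mat[of _ n n _ _ n])
  then show ?thesis using U e(1) f(1) unfolding orthogonally_pd_def
    by (auto intro!: exI[of _ "\<lambda>k. e k + f k"] add_pos_pos)
qed

lemma orthogonally_pd_smult:
  assumes "orthogonally_pd n U X" "c > 0"
  shows "orthogonally_pd n U (c \<cdot>\<^sub>m X)"
proof -
  from assms(1) obtain e where U: "U \<in> carrier_mat n n" "transpose_mat U = U" "U * U = 1\<^sub>m n"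
    and e: "\<And>k. k < n \<Longrightarrow> e k > 0" "X = U * mat_diag n e * U"
    unfolding orthogonally_pd_def by auto
  have "mat_diag n (\<lambda>k. c * e k) = c \<cdot>\<^sub>m mat_diag n e"
    by (auto simp: mat_diag_def)
  then have "U * mat_diag n (\<lambda>k. c * e k) * U = c \<cdot>\<^sub>m X"
    using U(1) unfolding e(2)
    by (simp add: mult_smult_distrib[of _ n n _ n] mult_smult_assoc_mat[of _ n n _ n])
  then show ?thesis using U e(1) assms(2) unfolding orthogonally_pd_def
    by (auto intro!: exI[of _ "\<lambda>k. c * e k"] mult_pos_pos)
qed

text \<open>Resolves the two definite descriptions behind \<open>inv_sqrt_mat\<close>: taking roots
  and reciprocal roots of the eigenvalues gives the witnesses, \<open>spd_sqrt_unique\<close> and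
  associativity give uniqueness.\<close>

lemma inv_sqrt_mat_props:
  assumes "orthogonally_pd n U P"
  shows "inv_sqrt_mat P \<in> carrier_mat n n"
    and "transpose_mat (inv_sqrt_mat P) = inv_sqrt_mat P"
    and "inv_sqrt_mat P * P * inv_sqrt_mat P = 1\<^sub>m n"
proof -
  from assms obtain e where U: "U \<in> carrier_mat n n" "transpose_mat U = U" "U * U = 1\<^sub>m n"
    and e: "\<And>k. k < n \<Longrightarrow> e k > 0" "P = U * mat_diag n e * U"
    unfolding orthogonally_pd_def by auto
  define R where "R = U * mat_diag n (\<lambda>k. sqrt (e k)) * U"
  define W where "W = U * mat_diag n (\<lambda>k. 1 / sqrt (e k)) * U"
  have P: "P \<in> carrier_mat n n" using U(1) by (simp add: e(2) mult_carrier_mat[of _ n n _ n])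
  have R: "R \<in> carrier_mat n n" and W: "W \<in> carrier_mat n n" using U(1)
    by (simp_all add: R_def W_def mult_carrier_mat[of _ n n _ n])
  have diag_cong: "mat_diag n f = mat_diag n g" if "\<And>k. k < n \<Longrightarrow> f k = g k" for f g :: "nat \<Rightarrow> real"
    using that by (auto simp: mat_diag_def intro!: eq_matI)
  have one: "U * mat_diag n f * U = 1\<^sub>m n" if "\<And>k. k < n \<Longrightarrow> f k = 1" for f
    using U diag_cong[of f "\<lambda>_. 1"] that by simp
  have RR: "R * R = P"
    unfolding R_def e(2) conjugate_mult[OF U(1,3) mat_diag_dim mat_diag_dim] mat_diag_diag
    using e(1) diag_cong[of "\<lambda>k. sqrt (e k) * sqrt (e k)" e] by (simp add: less_imp_le)
  have RW: "R * W = 1\<^sub>m n" and WR: "W * R = 1\<^sub>m n"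
    unfolding R_def W_def conjugate_mult[OF U(1,3) mat_diag_dim mat_diag_dim] mat_diag_diag
    using e(1) by (auto intro!: one simp: less_imp_neq[THEN not_sym])
  have spdR: "spd_mat R"
  proof (rule orthogonally_pd_imp_spd)
    show "orthogonally_pd n U R" unfolding orthogonally_pd_def R_def
      using U e(1) by (auto intro!: exI[of _ "\<lambda>k. sqrt (e k)"])
  qed
  have "sqrt_mat P = R"
    unfolding sqrt_mat_def
  proof (rule the_equality)
    show "R \<in> carrier_mat (dim_row P) (dim_row P) \<and> spd_mat R \<and> R * R = P"
      using R P spdR RR by auto
  qed (use P RR spd_sqrt_unique[OF _ _ spdR R] in auto)
  moreover have "inverse_mat R = W"
    unfolding inverse_mat_def inverts_mat_def
  proof (rule the_equality)
    show "W \<in> carrier_mat (dim_row R) (dim_row R) \<and> R * W = 1\<^sub>m (dim_row R) \<and> W * R = 1\<^sub>m (dim_row W)"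
      using R W RW WR by auto
  next
    fix N assume "N \<in> carrier_mat (dim_row R) (dim_row R) \<and> R * N = 1\<^sub>m (dim_row R) \<and> N * R = 1\<^sub>m (dim_row N)"
    then have N: "N \<in> carrier_mat n n" "R * N = 1\<^sub>m n" using R by auto
    have "N = (W * R) * N" using N WR by simp
    also have "\<dots> = W" using N W R by (simp add: assoc_mult_mat[of _ n n _ n _ n] mult_carrier_mat[of _ n n _ n])
    finally show "N = W" .
  qed
  ultimately have inv: "inv_sqrt_mat P = W" by (simp add: inv_sqrt_mat_def)
  show "inv_sqrt_mat P \<in> carrier_mat n n" using inv W by simp
  show "transpose_mat (inv_sqrt_mat P) = inv_sqrt_mat P"
    unfolding inv W_def using U(1,2)
    by (simp add: transpose_mult[of _ n n _ n] transpose_mat_diag assoc_mult_mat[of _ n n _ n _ n] mult_carrier_mat[of _ n n _ n])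
  have "W * P * W = (W * R) * (R * W)"
    unfolding RR[symmetric] using R W by (simp add: assoc_mult_mat[of _ n n _ n _ n] mult_carrier_mat[of _ n n _ n])
  then show "inv_sqrt_mat P * P * inv_sqrt_mat P = 1\<^sub>m n" unfolding inv using RW WR by simp
qed

section \<open>Kronecker products\<close>

lemma sum_mult_index:
  fixes f :: "nat \<Rightarrow> real"
  shows "(\<Sum>k<b * q. f k) = (\<Sum>a<b. \<Sum>c<q. f (a * q + c))"
proof -
  have "sum f {a * q..<a * q + q} = (\<Sum>c<q. f (a * q + c))" for a
    using sum.shift_bounds_nat_ivl[of f 0 "a * q" q] by (simp add: atLeast0LessThan add_ac)
  then show ?thesis by (simp flip: sum.nat_group)
qed

lemma mult_index_less: "a < (b::nat) \<Longrightarrow> c < q \<Longrightarrow> a * q + c < b * q"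
  using mult_le_mono1[of "Suc a" b q] by simp

lemma kronecker_dims [simp]:
  "dim_row (X \<otimes>\<^sub>k Y) = dim_row X * dim_row Y" "dim_col (X \<otimes>\<^sub>k Y) = dim_col X * dim_col Y"
  by (simp_all add: kronecker_def)

lemma kronecker_carrier [simp]:
  "X \<in> carrier_mat a b \<Longrightarrow> Y \<in> carrier_mat p q \<Longrightarrow> X \<otimes>\<^sub>k Y \<in> carrier_mat (a * p) (b * q)"
  by (auto simp: kronecker_def)

lemma kronecker_index:
  assumes "X \<in> carrier_mat a b" "Y \<in> carrier_mat p q" "i < a * p" "j < b * q"
  shows "(X \<otimes>\<^sub>k Y) $$ (i, j) = X $$ (i div p, j div q) * Y $$ (i mod p, j mod q)"
  using assms by (auto simp: kronecker_def)

lemma mod_less_of_mult: "i < a * p \<Longrightarrow> i mod p < (p::nat)"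
  by (cases p) auto

lemma transpose_kronecker:
  "transpose_mat (X \<otimes>\<^sub>k Y) = transpose_mat X \<otimes>\<^sub>k transpose_mat Y"
  by (rule eq_matI) (auto simp: kronecker_def less_mult_imp_div_less mod_less_of_mult)

lemma kronecker_mult:
  assumes A: "A \<in> carrier_mat a b" "B \<in> carrier_mat b c"
    and C: "C \<in> carrier_mat p q" "D \<in> carrier_mat q r"
  shows "(A \<otimes>\<^sub>k C) * (B \<otimes>\<^sub>k D) = (A * B) \<otimes>\<^sub>k (C * D)"
proof (rule eq_matI)
  fix i j assume "i < dim_row ((A * B) \<otimes>\<^sub>k (C * D))" "j < dim_col ((A * B) \<otimes>\<^sub>k (C * D))"
  then have ij: "i < a * p" "j < c * r" using A C by auto
  have ij': "i div p < a" "i mod p < p" "j div r < c" "j mod r < r"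
    using ij by (auto simp: less_mult_imp_div_less mod_less_of_mult)
  have "((A \<otimes>\<^sub>k C) * (B \<otimes>\<^sub>k D)) $$ (i, j) = (\<Sum>k<b * q. (A \<otimes>\<^sub>k C) $$ (i, k) * (B \<otimes>\<^sub>k D) $$ (k, j))"
    using ij A C by (simp add: scalar_prod_def atLeast0LessThan)
  also have "\<dots> = (\<Sum>k<b * q. (A $$ (i div p, k div q) * C $$ (i mod p, k mod q)) *
      (B $$ (k div q, j div r) * D $$ (k mod q, j mod r)))"
    using ij by (intro sum.cong refl) (simp add: kronecker_index[OF A(1) C(1)] kronecker_index[OF A(2) C(2)])
  also have "\<dots> = (\<Sum>k<b. \<Sum>l<q. (A $$ (i div p, k) * B $$ (k, j div r)) * (C $$ (i mod p, l) * D $$ (l, j mod r)))"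
    unfolding sum_mult_index by (intro sum.cong refl) (auto simp: mult_ac)
  also have "\<dots> = (A * B) $$ (i div p, j div r) * (C * D) $$ (i mod p, j mod r)"
    using ij' A C by (simp add: scalar_prod_def atLeast0LessThan sum_product)
  also have "\<dots> = ((A * B) \<otimes>\<^sub>k (C * D)) $$ (i, j)"
    using ij A C by (intro kronecker_index[of _ a c _ p r, symmetric]) auto
  finally show "((A \<otimes>\<^sub>k C) * (B \<otimes>\<^sub>k D)) $$ (i, j) = ((A * B) \<otimes>\<^sub>k (C * D)) $$ (i, j)" .
qed (use A C in auto)

lemma kronecker_mat_diag:
  "mat_diag n e \<otimes>\<^sub>k mat_diag p f = mat_diag (n * p) (\<lambda>i. e (i div p) * f (i mod p))"
proof (rule eq_matI)
  fix i j assume "i < dim_row (mat_diag (n * p) (\<lambda>i. e (i div p) * f (i mod p)))"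
    "j < dim_col (mat_diag (n * p) (\<lambda>i. e (i div p) * f (i mod p)))"
  then have ij: "i < n * p" "j < n * p" by auto
  have "i = j \<longleftrightarrow> i div p = j div p \<and> i mod p = j mod p" by (metis div_mult_mod_eq)
  then show "(mat_diag n e \<otimes>\<^sub>k mat_diag p f) $$ (i, j) =
      mat_diag (n * p) (\<lambda>i. e (i div p) * f (i mod p)) $$ (i, j)"
    using ij by (auto simp: kronecker_def mat_diag_def less_mult_imp_div_less mod_less_of_mult)
qed auto

lemma kronecker_one: "1\<^sub>m n \<otimes>\<^sub>k 1\<^sub>m p = 1\<^sub>m (n * p)"
  using kronecker_mat_diag[of n "\<lambda>_. 1" p "\<lambda>_. 1"] by simp

lemma kronecker_linear_right:
  assumes "X \<in> carrier_mat a b" "Y \<in> carrier_mat p q" "Z \<in> carrier_mat p q"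
  shows "X \<otimes>\<^sub>k (c \<cdot>\<^sub>m Y + d \<cdot>\<^sub>m Z) = c \<cdot>\<^sub>m (X \<otimes>\<^sub>k Y) + d \<cdot>\<^sub>m (X \<otimes>\<^sub>k Z)"
proof (rule eq_matI)
  fix i j assume "i < dim_row (c \<cdot>\<^sub>m (X \<otimes>\<^sub>k Y) + d \<cdot>\<^sub>m (X \<otimes>\<^sub>k Z))"
    "j < dim_col (c \<cdot>\<^sub>m (X \<otimes>\<^sub>k Y) + d \<cdot>\<^sub>m (X \<otimes>\<^sub>k Z))"
  then have ij: "i < a * p" "j < b * q" using assms by auto
  then have "i mod p < p" "j mod q < q" by (auto intro: mod_less_of_mult)
  then show "(X \<otimes>\<^sub>k (c \<cdot>\<^sub>m Y + d \<cdot>\<^sub>m Z)) $$ (i, j) = (c \<cdot>\<^sub>m (X \<otimes>\<^sub>k Y) + d \<cdot>\<^sub>m (X \<otimes>\<^sub>k Z)) $$ (i, j)"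
    using assms ij by (simp add: kronecker_def algebra_simps)
qed (use assms in auto)

lemma kronecker_linear_left:
  assumes "X \<in> carrier_mat a b" "Y \<in> carrier_mat p q" "Z \<in> carrier_mat p q"
  shows "(c \<cdot>\<^sub>m Y + d \<cdot>\<^sub>m Z) \<otimes>\<^sub>k X = c \<cdot>\<^sub>m (Y \<otimes>\<^sub>k X) + d \<cdot>\<^sub>m (Z \<otimes>\<^sub>k X)"
  using assms by (intro eq_matI) (auto simp: kronecker_def less_mult_imp_div_less algebra_simps)

lemma symmetric_kronecker:
  "symmetric_mat X \<Longrightarrow> symmetric_mat Y \<Longrightarrow> symmetric_mat (X \<otimes>\<^sub>k Y)"
  by (simp add: symmetric_mat_def transpose_kronecker)

text \<open>The product is block diagonal with blocks \<open>e a\<close> times \<open>Y\<close>, so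
  the quadratic form decouples over consecutive slices of the vector.\<close>

lemma spd_kronecker_diag_left:
  assumes e: "\<And>k. k < n \<Longrightarrow> e k > 0" and Y: "spd_mat Y" "Y \<in> carrier_mat p p"
  shows "spd_mat (mat_diag n e \<otimes>\<^sub>k Y)"
proof (rule spd_matI)
  let ?M = "mat_diag n e \<otimes>\<^sub>k Y"
  show M: "?M \<in> carrier_mat (n * p) (n * p)" using Y by simp
  show "symmetric_mat ?M"
    using spd_matD(1)[OF Y] by (intro symmetric_kronecker) (simp_all add: symmetric_mat_def transpose_mat_diag)
  fix v :: "real Matrix.vec" assume v: "v \<in> carrier_vec (n * p)" "v \<noteq> 0\<^sub>v (n * p)"
  define w where "w a = Matrix.vec p (\<lambda>c. v $ (a * p + c))" for a
  have w: "w a \<in> carrier_vec p" for a by (simp add: w_def)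
  have M_index: "?M $$ (a * p + c, a' * p + c') = (if a' = a then e a * Y $$ (c, c') else 0)"
    if "a < n" "c < p" "a' < n" "c' < p" for a c a' c'
    using that by (subst kronecker_index[OF mat_diag_dim Y(2)]) (auto simp: mult_index_less mat_diag_def)
  have "v \<bullet> (?M *\<^sub>v v) = (\<Sum>a<n. \<Sum>c<p. \<Sum>a'<n. \<Sum>c'<p.
      ?M $$ (a * p + c, a' * p + c') * v $ (a * p + c) * v $ (a' * p + c'))"
    unfolding quadratic_form_eq_sum[OF M v(1)] sum_mult_index ..
  also have "\<dots> = (\<Sum>a<n. \<Sum>c<p. \<Sum>a'<n. if a' = a then
      e a * (\<Sum>c'<p. Y $$ (c, c') * w a $ c * w a $ c') else 0)"
    by (intro sum.cong refl)
       (auto simp: w_def M_index sum_distrib_left mult_ac intro!: sum.cong)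
  also have "\<dots> = (\<Sum>a<n. e a * (w a \<bullet> (Y *\<^sub>v w a)))"
    unfolding quadratic_form_eq_sum[OF Y(2) w] by (simp add: sum_distrib_left)
  also have "\<dots> > 0"
  proof -
    obtain k where k: "k < n * p" "v $ k \<noteq> 0"
      using v by (metis carrier_vecD eq_vecI index_zero_vec)
    have km: "k div p < n" "k mod p < p" using k by (auto simp: less_mult_imp_div_less mod_less_of_mult)
    have "w (k div p) $ (k mod p) \<noteq> 0" using k km by (simp add: w_def)
    then have "w (k div p) \<noteq> 0\<^sub>v p" using km by auto
    then have "w (k div p) \<bullet> (Y *\<^sub>v w (k div p)) > 0" using spd_matD(2)[OF Y w] by simp
    moreover have "w a \<bullet> (Y *\<^sub>v w a) \<ge> 0" for a using spd_matD(3)[OF Y w] .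
    ultimately show ?thesis
      using e km(1) by (intro sum_pos2[of _ "k div p"]) (auto simp: less_imp_le)
  qed
  finally show "v \<bullet> (?M *\<^sub>v v) > 0" .
qed

text \<open>The same decoupling with the factors exchanged: the slices \<open>w a\<close> now
  collect entries at stride \<open>n\<close>.\<close>

lemma spd_kronecker_diag_right:
  assumes e: "\<And>k. k < n \<Longrightarrow> e k > 0" and Y: "spd_mat Y" "Y \<in> carrier_mat p p"
  shows "spd_mat (Y \<otimes>\<^sub>k mat_diag n e)"
proof (rule spd_matI)
  let ?M = "Y \<otimes>\<^sub>k mat_diag n e"
  show M: "?M \<in> carrier_mat (p * n) (p * n)" using Y by simp
  show "symmetric_mat ?M"
    using spd_matD(1)[OF Y] by (intro symmetric_kronecker) (simp_all add: symmetric_mat_def transpose_mat_diag)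
  fix v :: "real Matrix.vec" assume v: "v \<in> carrier_vec (p * n)" "v \<noteq> 0\<^sub>v (p * n)"
  define w where "w a = Matrix.vec p (\<lambda>c. v $ (c * n + a))" for a
  have w: "w a \<in> carrier_vec p" for a by (simp add: w_def)
  have M_index: "?M $$ (c * n + a, c' * n + a') = (if a' = a then e a * Y $$ (c, c') else 0)"
    if "a < n" "c < p" "a' < n" "c' < p" for a c a' c'
    using that by (subst kronecker_index[OF Y(2) mat_diag_dim]) (auto simp: mult_index_less mat_diag_def)
  have "v \<bullet> (?M *\<^sub>v v) = (\<Sum>c<p. \<Sum>a<n. \<Sum>c'<p. \<Sum>a'<n.
      ?M $$ (c * n + a, c' * n + a') * v $ (c * n + a) * v $ (c' * n + a'))"
    unfolding quadratic_form_eq_sum[OF M v(1)] sum_mult_index ..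
  also have "\<dots> = (\<Sum>c<p. \<Sum>a<n. \<Sum>c'<p. \<Sum>a'<n. if a' = a then
      e a * (Y $$ (c, c') * w a $ c * w a $ c') else 0)"
    by (intro sum.cong refl)
       (auto simp: w_def M_index mult_ac)
  also have "\<dots> = (\<Sum>c<p. \<Sum>a<n. e a * (\<Sum>c'<p. Y $$ (c, c') * w a $ c * w a $ c'))"
    by (simp add: sum_distrib_left)
  also have "\<dots> = (\<Sum>a<n. e a * (w a \<bullet> (Y *\<^sub>v w a)))"
    unfolding quadratic_form_eq_sum[OF Y(2) w] by (subst sum.swap) (simp add: sum_distrib_left)
  also have "\<dots> > 0"
  proof -
    obtain k where k: "k < p * n" "v $ k \<noteq> 0"
      using v by (metis carrier_vecD eq_vecI index_zero_vec)
    have km: "k div n < p" "k mod n < n" using k by (auto simp: less_mult_imp_div_less mod_less_of_mult)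
    have "w (k mod n) $ (k div n) \<noteq> 0" using k km by (simp add: w_def)
    then have "w (k mod n) \<noteq> 0\<^sub>v p" using km by auto
    then have "w (k mod n) \<bullet> (Y *\<^sub>v w (k mod n)) > 0" using spd_matD(2)[OF Y w] by simp
    moreover have "w a \<bullet> (Y *\<^sub>v w a) \<ge> 0" for a using spd_matD(3)[OF Y w] .
    ultimately show ?thesis
      using e km(2) by (intro sum_pos2[of _ "k mod n"]) (auto simp: less_imp_le)
  qed
  finally show "v \<bullet> (?M *\<^sub>v v) > 0" .
qed

text \<open>Only \<open>X\<close> is rotated to diagonal form, so \<open>Y\<close> may be any
  definite matrix. This matters because \<open>2 B - tau\<close> and \<open>3 tau - 2 B\<close> need
  not be diagonalized by the sine matrix.\<close>

lemma spd_kronecker_left: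
  assumes X: "orthogonally_pd n U X" and Y: "spd_mat Y" "Y \<in> carrier_mat p p"
  shows "spd_mat (X \<otimes>\<^sub>k Y)"
proof -
  from X obtain e where U: "U \<in> carrier_mat n n" "transpose_mat U = U" "U * U = 1\<^sub>m n"
    and e: "\<And>k. k < n \<Longrightarrow> e k > 0" "X = U * mat_diag n e * U"
    unfolding orthogonally_pd_def by auto
  let ?R = "U \<otimes>\<^sub>k 1\<^sub>m p"
  have R: "?R \<in> carrier_mat (n * p) (n * p)" "transpose_mat ?R = ?R" "?R * ?R = 1\<^sub>m (n * p)"
    using U by (simp_all add: transpose_kronecker kronecker_mult[of _ n n _ n _ p p _ p] kronecker_one)
  have "?R * (mat_diag n e \<otimes>\<^sub>k Y) * ?R = X \<otimes>\<^sub>k Y"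
    unfolding e(2) using U Y by (simp add: kronecker_mult[of _ n n _ n _ p p _ p])
  then show ?thesis
    using spd_mat_congruence[OF spd_kronecker_diag_left[of n e, OF e(1) Y] _ R(1) R(1) R(3)] R(2) Y by simp
qed

lemma spd_kronecker_right:
  assumes X: "orthogonally_pd n U X" and Y: "spd_mat Y" "Y \<in> carrier_mat p p"
  shows "spd_mat (Y \<otimes>\<^sub>k X)"
proof -
  from X obtain e where U: "U \<in> carrier_mat n n" "transpose_mat U = U" "U * U = 1\<^sub>m n"
    and e: "\<And>k. k < n \<Longrightarrow> e k > 0" "X = U * mat_diag n e * U"
    unfolding orthogonally_pd_def by auto
  let ?R = "1\<^sub>m p \<otimes>\<^sub>k U"
  have R: "?R \<in> carrier_mat (p * n) (p * n)" "transpose_mat ?R = ?R" "?R * ?R = 1\<^sub>m (p * n)"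
    using U by (simp_all add: transpose_kronecker kronecker_mult[of _ p p _ p _ n n _ n] kronecker_one)
  have "?R * (Y \<otimes>\<^sub>k mat_diag n e) * ?R = Y \<otimes>\<^sub>k X"
    unfolding e(2) using U Y by (simp add: kronecker_mult[of _ p p _ p _ n n _ n])
  then show ?thesis
    using spd_mat_congruence[OF spd_kronecker_diag_right[of n e, OF e(1) Y] _ R(1) R(1) R(3)] R(2) Y by simp
qed

lemma orthogonally_pd_kronecker:
  assumes "orthogonally_pd n U X" "orthogonally_pd p V Y"
  shows "orthogonally_pd (n * p) (U \<otimes>\<^sub>k V) (X \<otimes>\<^sub>k Y)"
proof -
  from assms obtain e f where U: "U \<in> carrier_mat n n" "transpose_mat U = U" "U * U = 1\<^sub>m n"
    and e: "\<And>k. k < n \<Longrightarrow> e k > 0" "X = U * mat_diag n e * U"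
    and V: "V \<in> carrier_mat p p" "transpose_mat V = V" "V * V = 1\<^sub>m p"
    and f: "\<And>k. k < p \<Longrightarrow> f k > 0" "Y = V * mat_diag p f * V"
    unfolding orthogonally_pd_def by auto
  note mult = kronecker_mult[of _ n n _ n _ p p _ p]
  have "X \<otimes>\<^sub>k Y = (U \<otimes>\<^sub>k V) * (mat_diag n e \<otimes>\<^sub>k mat_diag p f) * (U \<otimes>\<^sub>k V)"
    unfolding e(2) f(2) using U V by (simp add: mult)
  also have "mat_diag n e \<otimes>\<^sub>k mat_diag p f = mat_diag (n * p) (\<lambda>i. e (i div p) * f (i mod p))"
    by (rule kronecker_mat_diag)
  finally have "X \<otimes>\<^sub>k Y = (U \<otimes>\<^sub>k V) * mat_diag (n * p) (\<lambda>i. e (i div p) * f (i mod p)) * (U \<otimes>\<^sub>k V)" .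
  moreover have "e (i div p) * f (i mod p) > 0" if "i < n * p" for i
    using that e(1) f(1) by (simp add: less_mult_imp_div_less mod_less_of_mult)
  moreover have "(U \<otimes>\<^sub>k V) * (U \<otimes>\<^sub>k V) = 1\<^sub>m (n * p)" "transpose_mat (U \<otimes>\<^sub>k V) = U \<otimes>\<^sub>k V"
    using U V by (simp_all add: mult kronecker_one transpose_kronecker)
  ultimately show ?thesis using U(1) V(1) unfolding orthogonally_pd_def
    by (auto intro!: exI[of _ "\<lambda>i. e (i div p) * f (i mod p)"])
qed

section \<open>Spectral bounds for the preconditioned matrix\<close>

lemma symmetric_toeplitz: "symmetric_mat (toeplitz_mat n t)"
  unfolding symmetric_mat_def by (rule eq_matI) (auto simp: toeplitz_mat_def)

lemma symmetric_hankel: "symmetric_mat (hankel_mat n t)"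
  unfolding symmetric_mat_def by (rule eq_matI) (auto simp: hankel_mat_def add_ac diff_diff_eq)

text \<open>Off the diagonal, at most one of the two Hankel terms is nonzero because their indices add up
  to \<^term>\<open>2 * n + 2\<close>; so monotonicity of \<^term>\<open>t\<close> makes the Toeplitz entry the smaller one.
  Hence \<^term>\<open>c = (1::real)\<close> gives the smallest diagonal and the largest moduli off it.\<close>

lemma spd_toeplitz_hankel:
  fixes t :: "nat \<Rightarrow> real"
  assumes neg: "\<And>m. m \<ge> 1 \<Longrightarrow> t m \<le> 0"
    and mono: "\<And>m m'. 1 \<le> m \<Longrightarrow> m + 2 \<le> m' \<Longrightarrow> t m \<le> t m'"
    and pos: "t 0 + 2 * (\<Sum>m=1..<n. t m) > 0"
    and c: "- 3 \<le> c" "c \<le> 1"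
  shows "spd_mat (toeplitz_mat n t + c \<cdot>\<^sub>m hankel_mat n t)" (is "spd_mat ?M")
proof (rule spd_mat_diag_dominant)
  let ?T = "toeplitz_mat n t" and ?H = "hankel_mat n t"
  show "?M \<in> carrier_mat n n" by simp
  show "symmetric_mat ?M"
    using symmetric_toeplitz symmetric_hankel unfolding symmetric_mat_def
    by (subst transpose_add[of _ n n]) (auto simp: transpose_smult_mat)
  fix i assume i: "i < n"
  have H: "?H $$ (i, j) \<le> 0" if "j < n" for j
    using i that neg by (auto simp: hankel_mat_def truncate_at_def)
  have TH: "?T $$ (i, j) \<le> ?H $$ (i, j)" if j: "j < n" "j \<noteq> i" for j
  proof -
    define m where "m = (if j \<le> i then i - j else j - i)"
    have m: "1 \<le> m" "m + 2 \<le> i + j + 2" "m + 2 \<le> 2 * n - i - j" using i j by (auto simp: m_def)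
    have "i + j + 2 \<ge> n \<or> 2 * n - i - j \<ge> n" using i j by auto
    then have "t m \<le> truncate_at n t (i + j + 2) + truncate_at n t (2 * n - i - j)"
      using mono[OF m(1,2)] mono[OF m(1,3)] neg[OF m(1)] by (auto simp: truncate_at_def)
    then show ?thesis using i j by (simp add: toeplitz_mat_def hankel_mat_def m_def)
  qed
  have "(\<Sum>j\<in>{..<n}-{i}. \<bar>?M $$ (i, j)\<bar>) \<le> (\<Sum>j\<in>{..<n}-{i}. - (?T $$ (i, j) + ?H $$ (i, j)))"
  proof (rule sum_mono)
    fix j assume "j \<in> {..<n} - {i}"
    then have j: "j < n" "j \<noteq> i" by auto
    \<comment> \<open>The two sides of the absolute value use the two bounds on \<open>c\<close>:
      \<open>c <= 1\<close> gives \<open>T + H <= T + c H\<close>, while \<open>T <= H\<close> and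
      \<open>c >= -3\<close> give \<open>2 T <= 2 H <= - (1 + c) H\<close>.\<close>
    have "0 \<le> (c + 3) * - ?H $$ (i, j)" "0 \<le> (1 - c) * - ?H $$ (i, j)"
      using c H[OF j(1)] by (intro mult_nonneg_nonneg; simp)+
    then have "- 3 * - ?H $$ (i, j) \<le> c * - ?H $$ (i, j)" "c * - ?H $$ (i, j) \<le> - ?H $$ (i, j)"
      by (simp_all add: algebra_simps)
    then show "\<bar>?M $$ (i, j)\<bar> \<le> - (?T $$ (i, j) + ?H $$ (i, j))"
      using TH[OF j] H[OF j(1)] i j by (simp add: abs_le_iff)
  qed
  also have "\<dots> < ?T $$ (i, i) + ?H $$ (i, i)"
  proof -
    have "(\<Sum>j<n. ?T $$ (i, j) + ?H $$ (i, j)) > 0"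
      using row_sum_toeplitz_hankel[OF i, of t] neg pos by force
    then show ?thesis using i unfolding sum_negf by (subst (asm) sum.remove[of _ i]) auto
  qed
  also have "\<dots> \<le> ?M $$ (i, i)"
  proof -
    have "0 \<le> (1 - c) * - ?H $$ (i, i)"
      using c H[OF i] by (intro mult_nonneg_nonneg) auto
    then show ?thesis using i by (simp add: algebra_simps)
  qed
  finally show "(\<Sum>j\<in>{..<n}-{i}. \<bar>?M $$ (i, j)\<bar>) < ?M $$ (i, i)" .
qed

lemma transpose_sine_mat: "transpose_mat (sine_mat n) = sine_mat n"
  by (rule eq_matI) (auto simp: sine_mat_def mult_ac)

text \<open>Hankel indices are at least 2, so the correction of a tridiagonal matrix vanishes and
  \<open>A_mat n\<close> is its own \<open>tau\<close> matrix. Its eigenvalues are at least 6/8 -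
  2/8 = 1/2.\<close>

lemma orthogonally_pd_A_mat:
  assumes "n > 0"
  shows "orthogonally_pd n (sine_mat n) (A_mat n)"
proof -
  define a :: "nat \<Rightarrow> real" where "a m = (if m = 0 then 6/8 else if m = 1 then 1/8 else 0)" for m
  have A: "A_mat n = toeplitz_mat n a"
    by (rule eq_matI) (auto simp: A_mat_def toeplitz_mat_def a_def)
  have "hankel_mat n a = 0\<^sub>m n n"
    by (rule eq_matI) (auto simp: hankel_mat_def truncate_at_def a_def)
  moreover have minus_zero: "toeplitz_mat n a - 0\<^sub>m n n = toeplitz_mat n a" by (rule eq_matI) auto
  ultimately have "A_mat n = sine_mat n * mat_diag n (tau_eigenvalue n a) * sine_mat n"
    using tau_mat_toeplitz[OF assms, of a] tau_mat_toeplitz_sine[OF assms, of a] A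
    by (simp add: minus_zero)
  moreover have "tau_eigenvalue n a k > 0" for k
  proof -
    let ?x = "real (k + 1) * pi / (real n + 1)"
    have "(\<Sum>m=1..<n. a m * cos (real m * ?x)) = (\<Sum>m=1..<n. if m = 1 then cos ?x / 8 else 0)"
      by (intro sum.cong) (auto simp: a_def)
    also have "\<dots> = (if 1 < n then cos ?x / 8 else 0)" by simp
    also have "\<dots> \<ge> - 1/8" using cos_ge_minus_one[of ?x] by auto
    finally show ?thesis unfolding tau_eigenvalue_def by (simp add: a_def)
  qed
  ultimately show ?thesis
    using sine_mat_involution transpose_sine_mat unfolding orthogonally_pd_def
    by (auto intro!: exI[of _ "tau_eigenvalue n a"])
qed

section \<open>Toeplitz coefficients of the symmetric diffusion matrix\<close>

text \<open>At distance \<open>m\<close> from the diagonal one of \<open>T\<close> and its transpose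
  contributes \<open>q_(m+1)\<close>. The other reaches past its diagonal only by the Hessenberg
  band: \<open>q_1\<close> again for \<open>m = 0\<close>, and \<open>q_0\<close> for
  \<open>m = 1\<close>.\<close>

definition riesz_coeff :: "real \<Rightarrow> real \<Rightarrow> nat \<Rightarrow> real" where
  "riesz_coeff k d m = k * (q_coeff d (m + 1) + (if m \<le> 1 then q_coeff d (1 - m) else 0))"

lemma B_mat_toeplitz: "B_mat n d k k = toeplitz_mat n (riesz_coeff k d)"
proof (rule eq_matI)
  fix i j assume "i < dim_row (toeplitz_mat n (riesz_coeff k d))" "j < dim_col (toeplitz_mat n (riesz_coeff k d))"
  then have ij: "i < n" "j < n" by auto
  have *: "(if j \<le> i + 1 then q_coeff d (i + 1 - j) else 0) + (if i \<le> j + 1 then q_coeff d (j + 1 - i) else 0)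
      = q_coeff d (m + 1) + (if m \<le> 1 then q_coeff d (1 - m) else 0)"
    if "m = (if j \<le> i then i - j else j - i)" for m
  proof (cases "j \<le> i")
    case True
    then have "i + 1 - j = m + 1" "i \<le> j + 1 \<longleftrightarrow> m \<le> 1" "j + 1 - i = 1 - m" using that by auto
    then show ?thesis using True by simp
  next
    case False
    then have "j + 1 - i = m + 1" "j \<le> i + 1 \<longleftrightarrow> m \<le> 1" "i + 1 - j = 1 - m" using that by auto
    then show ?thesis using False by simp
  qed
  show "B_mat n d k k $$ (i, j) = toeplitz_mat n (riesz_coeff k d) $$ (i, j)"
    using ij *[OF refl] unfolding B_mat_def T_mat_def toeplitz_mat_def riesz_coeff_def
    by (simp flip: distrib_left)
qed (auto simp: B_mat_def T_mat_def)

lemma sym_part_symmetric: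
  assumes "symmetric_mat X"
  shows "sym_part X = X"
  using assms unfolding sym_part_def symmetric_mat_def by (intro eq_matI) auto

context
  fixes k d :: real
  assumes k: "k > 0" and d: "0 < d" "d < 1"
begin

lemma riesz_coeff_mono:
  assumes "1 \<le> m" "m + 2 \<le> m'"
  shows "riesz_coeff k d m \<le> riesz_coeff k d m'"
proof (cases "m = 1")
  case True
  have "q_coeff d 0 + q_coeff d 2 \<le> q_coeff d (m' + 1)"
    using q_coeff_0_2[OF d] q_coeff_mono[OF d, of 4 "m' + 1"] assms by simp
  then show ?thesis using True assms k by (simp add: riesz_coeff_def add.commute numeral_2_eq_2)
next
  case False
  then show ?thesis using assms k q_coeff_mono[OF d, of "m + 1" "m' + 1"] by (simp add: riesz_coeff_def)
qed

text \<open>For \<open>m = 1\<close> the sign of \<open>q_0 + q_2\<close> is not visible from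
  differences; comparing with distance \<open>m + 2\<close> moves to an index where
  \<open>q_coeff_bounds\<close> applies.\<close>

lemma riesz_coeff_nonpos:
  assumes "1 \<le> m"
  shows "riesz_coeff k d m \<le> 0"
proof -
  have "riesz_coeff k d m \<le> riesz_coeff k d (m + 2)" using assms by (intro riesz_coeff_mono) auto
  also have "riesz_coeff k d (m + 2) = k * q_coeff d (m + 3)"
    by (simp add: riesz_coeff_def numeral_3_eq_3 del: q_coeff.simps)
  also have "\<dots> \<le> 0"
    using q_coeff_bounds(1)[OF d, of m] k by (intro mult_nonneg_nonpos) auto
  finally show ?thesis .
qed

text \<open>Since \<open>t_0 = 2 k q_1\<close> and \<open>t_1 = k (q_0 + q_2)\<close>, the weighted
  sum contains every \<open>q_j\<close> exactly \<open>2 k\<close> times and telescopes to a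
  negative multiple of some \<open>s_coeff\<close>.\<close>

lemma riesz_coeff_sum_pos: "riesz_coeff k d 0 + 2 * (\<Sum>m=1..<n. riesz_coeff k d m) > 0"
proof -
  have *: "riesz_coeff k d 0 + 2 * (\<Sum>m=1..<N+2. riesz_coeff k d m) = - 2 * k * s_coeff d (N + 2)" for N
  proof -
    have "riesz_coeff k d 0 + 2 * (\<Sum>m=1..<N+2. riesz_coeff k d m) = 2 * k * (\<Sum>j\<le>N+2. q_coeff d j)"
    proof (induction N)
      case 0
      show ?case by (simp add: riesz_coeff_def numeral_2_eq_2 algebra_simps del: q_coeff.simps)
    next
      case (Suc N)
      have "(\<Sum>m=1..<Suc N+2. riesz_coeff k d m) = (\<Sum>m=1..<N+2. riesz_coeff k d m) + riesz_coeff k d (N + 2)"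
        by simp
      moreover have "riesz_coeff k d (N + 2) = k * q_coeff d (Suc (N + 2))" by (simp add: riesz_coeff_def)
      moreover have "(\<Sum>j\<le>Suc N+2. q_coeff d j) = (\<Sum>j\<le>N+2. q_coeff d j) + q_coeff d (Suc (N + 2))"
        by simp
      ultimately show ?case using Suc.IH by (simp only: distrib_left)
    qed
    also have "\<dots> = - 2 * k * s_coeff d (N + 2)"
      unfolding sum_q_coeff by (simp del: s_coeff.simps)
    finally show ?thesis .
  qed
  have "s_coeff d (N + 2) < 0" for N using s_coeff_neg[OF d] .
  then have pos: "riesz_coeff k d 0 + 2 * (\<Sum>m=1..<N+2. riesz_coeff k d m) > 0" for N
    unfolding * using k by (simp add: mult_pos_neg)
  \<comment> \<open>For \<open>n <= 1\<close> the sum is empty; then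
    \<open>t_0 > - 2 t_1 >= 0\<close> follows from the case \<open>n = 2\<close>.\<close>
  show ?thesis
  proof (cases "n \<ge> 2")
    case True
    then have "n - 2 + 2 = n" by simp
    then show ?thesis using pos[of "n - 2"] by (simp only:)
  next
    case False
    then have "(\<Sum>m=1..<n. riesz_coeff k d m) = 0" by simp
    moreover have "riesz_coeff k d 1 \<le> 0" by (rule riesz_coeff_nonpos) simp
    ultimately show ?thesis using pos[of 0] by (simp add: numeral_2_eq_2)
  qed
qed

lemma spd_riesz:
  assumes "- 3 \<le> c" "c \<le> 1"
  shows "spd_mat (toeplitz_mat n (riesz_coeff k d) + c \<cdot>\<^sub>m hankel_mat n (riesz_coeff k d))"
  using riesz_coeff_nonpos riesz_coeff_mono riesz_coeff_sum_pos assms by (rule spd_toeplitz_hankel)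

text \<open>Substituting \<open>tau = T - H\<close> turns the three definiteness claims into
  \<open>spd_riesz\<close> at \<open>c = -1\<close>, \<open>c = 1\<close> and
  \<open>c = -3\<close>.\<close>

lemma tau_riesz:
  assumes "n > 0"
  shows "tau_mat (sym_part (B_mat n d k k)) \<in> carrier_mat n n"
    and "orthogonally_pd n (sine_mat n) (tau_mat (sym_part (B_mat n d k k)))"
    and "spd_mat (2 \<cdot>\<^sub>m B_mat n d k k + (- 1) \<cdot>\<^sub>m tau_mat (sym_part (B_mat n d k k)))"
    and "spd_mat ((- 2) \<cdot>\<^sub>m B_mat n d k k + 3 \<cdot>\<^sub>m tau_mat (sym_part (B_mat n d k k)))"
proof -
  let ?T = "toeplitz_mat n (riesz_coeff k d)" and ?H = "hankel_mat n (riesz_coeff k d)"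
  have tau: "tau_mat (sym_part (B_mat n d k k)) = ?T - ?H"
    using sym_part_symmetric[OF symmetric_toeplitz] tau_mat_toeplitz[OF assms] by (simp add: B_mat_toeplitz)
  then show "tau_mat (sym_part (B_mat n d k k)) \<in> carrier_mat n n" by (simp add: minus_carrier_mat)
  have "?T + (- 1) \<cdot>\<^sub>m ?H = ?T - ?H" by (rule eq_matI) auto
  then have "spd_mat (tau_mat ?T)" using spd_riesz[of "- 1" n] tau_mat_toeplitz[OF assms] by simp
  then show "orthogonally_pd n (sine_mat n) (tau_mat (sym_part (B_mat n d k k)))"
    using orthogonally_pdI[OF sine_mat_carrier transpose_sine_mat sine_mat_involution]
      tau_mat_toeplitz_sine[OF assms] sym_part_symmetric[OF symmetric_toeplitz]
    by (simp add: B_mat_toeplitz)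
  have "2 \<cdot>\<^sub>m B_mat n d k k + (- 1) \<cdot>\<^sub>m (?T - ?H) = ?T + 1 \<cdot>\<^sub>m ?H"
    unfolding B_mat_toeplitz by (rule eq_matI) auto
  then show "spd_mat (2 \<cdot>\<^sub>m B_mat n d k k + (- 1) \<cdot>\<^sub>m tau_mat (sym_part (B_mat n d k k)))"
    using spd_riesz[of 1 n] tau by simp
  have "(- 2) \<cdot>\<^sub>m B_mat n d k k + 3 \<cdot>\<^sub>m (?T - ?H) = ?T + (- 3) \<cdot>\<^sub>m ?H"
    unfolding B_mat_toeplitz by (rule eq_matI) auto
  then show "spd_mat ((- 2) \<cdot>\<^sub>m B_mat n d k k + 3 \<cdot>\<^sub>m tau_mat (sym_part (B_mat n d k k)))"
    using spd_riesz[of "- 3" n] tau by simp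
qed

end

section \<open>Assembly of the three directions and the eigenvalue bounds\<close>

lemma A_mat_carrier [simp]: "A_mat n \<in> carrier_mat n n"
  by (simp add: A_mat_def)

lemma kron_sum_carrier:
  assumes "\<And>i. i \<in> {1, 2, 3} \<Longrightarrow> X i \<in> carrier_mat (n i) (n i)"
  shows "kron_sum e n X \<in> carrier_mat (n 3 * n 2 * n 1) (n 3 * n 2 * n 1)"
  using assms[of 1] assms[of 2] assms[of 3] unfolding kron_sum_def by simp

text \<open>The summand without \<open>X\<close> is constant, hence \<open>c + d = 1\<close>. The
  combinations 2 - 1 and -2 + 3 are normalized to meet this.\<close>

lemma kron_sum_affine:
  assumes X: "\<And>i. i \<in> {1, 2, 3} \<Longrightarrow> X i \<in> carrier_mat (n i) (n i)"
    and Y: "\<And>i. i \<in> {1, 2, 3} \<Longrightarrow> Y i \<in> carrier_mat (n i) (n i)"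
    and cd: "c + d = 1"
  shows "kron_sum e n (\<lambda>i. c \<cdot>\<^sub>m X i + d \<cdot>\<^sub>m Y i) = c \<cdot>\<^sub>m kron_sum e n X + d \<cdot>\<^sub>m kron_sum e n Y"
proof -
  let ?A = "\<lambda>i. A_mat (n i)"
  have X': "X 1 \<in> carrier_mat (n 1) (n 1)" "X 2 \<in> carrier_mat (n 2) (n 2)" "X 3 \<in> carrier_mat (n 3) (n 3)"
    and Y': "Y 1 \<in> carrier_mat (n 1) (n 1)" "Y 2 \<in> carrier_mat (n 2) (n 2)" "Y 3 \<in> carrier_mat (n 3) (n 3)"
    using X Y by auto
  have 1: "?A 3 \<otimes>\<^sub>k ?A 2 \<otimes>\<^sub>k (c \<cdot>\<^sub>m X 1 + d \<cdot>\<^sub>m Y 1) = c \<cdot>\<^sub>m (?A 3 \<otimes>\<^sub>k ?A 2 \<otimes>\<^sub>k X 1) + d \<cdot>\<^sub>m (?A 3 \<otimes>\<^sub>k ?A 2 \<otimes>\<^sub>k Y 1)"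
    by (rule kronecker_linear_right[OF _ X'(1) Y'(1)]) (rule kronecker_carrier; rule A_mat_carrier)
  have 2: "?A 3 \<otimes>\<^sub>k (c \<cdot>\<^sub>m X 2 + d \<cdot>\<^sub>m Y 2) \<otimes>\<^sub>k ?A 1 = c \<cdot>\<^sub>m (?A 3 \<otimes>\<^sub>k X 2 \<otimes>\<^sub>k ?A 1) + d \<cdot>\<^sub>m (?A 3 \<otimes>\<^sub>k Y 2 \<otimes>\<^sub>k ?A 1)"
    unfolding kronecker_linear_right[OF A_mat_carrier X'(2) Y'(2)]
    by (rule kronecker_linear_left[OF A_mat_carrier
          kronecker_carrier[OF A_mat_carrier X'(2)] kronecker_carrier[OF A_mat_carrier Y'(2)]])
  have 3: "(c \<cdot>\<^sub>m X 3 + d \<cdot>\<^sub>m Y 3) \<otimes>\<^sub>k ?A 2 \<otimes>\<^sub>k ?A 1 = c \<cdot>\<^sub>m (X 3 \<otimes>\<^sub>k ?A 2 \<otimes>\<^sub>k ?A 1) + d \<cdot>\<^sub>m (Y 3 \<otimes>\<^sub>k ?A 2 \<otimes>\<^sub>k ?A 1)"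
    unfolding kronecker_linear_left[OF A_mat_carrier X'(3) Y'(3)]
    by (rule kronecker_linear_left[OF A_mat_carrier
          kronecker_carrier[OF X'(3) A_mat_carrier] kronecker_carrier[OF Y'(3) A_mat_carrier]])
  let ?N = "n 3 * n 2 * n 1"
  have alg: "K + e1 \<cdot>\<^sub>m (c \<cdot>\<^sub>m K1 + d \<cdot>\<^sub>m L1) + e2 \<cdot>\<^sub>m (c \<cdot>\<^sub>m K2 + d \<cdot>\<^sub>m L2) + e3 \<cdot>\<^sub>m (c \<cdot>\<^sub>m K3 + d \<cdot>\<^sub>m L3)
    = c \<cdot>\<^sub>m (K + e1 \<cdot>\<^sub>m K1 + e2 \<cdot>\<^sub>m K2 + e3 \<cdot>\<^sub>m K3) + d \<cdot>\<^sub>m (K + e1 \<cdot>\<^sub>m L1 + e2 \<cdot>\<^sub>m L2 + e3 \<cdot>\<^sub>m L3)"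
    if "K \<in> carrier_mat ?N ?N" "K1 \<in> carrier_mat ?N ?N" "K2 \<in> carrier_mat ?N ?N" "K3 \<in> carrier_mat ?N ?N"
      "L1 \<in> carrier_mat ?N ?N" "L2 \<in> carrier_mat ?N ?N" "L3 \<in> carrier_mat ?N ?N"
    for K K1 K2 K3 L1 L2 L3 and e1 e2 e3 :: real
  proof (rule eq_matI, goal_cases)
    case (1 i j)
    then have ij: "i < ?N" "j < ?N" using that by auto
    have "K $$ (i, j) = c * K $$ (i, j) + d * K $$ (i, j)" using cd by (simp flip: distrib_right)
    then show ?case using ij that by (simp add: algebra_simps)
  qed (use that in auto)
  show ?thesis
    unfolding kron_sum_def 1 2 3 by (rule alg) (use X' Y' in auto)
qed

lemma orthogonally_pd_kron_sum:
  assumes n: "\<And>i. i \<in> {1, 2, 3} \<Longrightarrow> n i > 0"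
    and e: "\<And>i. i \<in> {1, 2, 3} \<Longrightarrow> e i > 0"
    and X: "\<And>i. i \<in> {1, 2, 3} \<Longrightarrow> orthogonally_pd (n i) (sine_mat (n i)) (X i)"
  shows "orthogonally_pd (n 3 * n 2 * n 1) (sine_mat (n 3) \<otimes>\<^sub>k sine_mat (n 2) \<otimes>\<^sub>k sine_mat (n 1)) (kron_sum e n X)"
  unfolding kron_sum_def
  by (intro orthogonally_pd_add orthogonally_pd_smult orthogonally_pd_kronecker orthogonally_pd_A_mat n e X) auto

text \<open>In each summand at most one factor lies outside the sine-diagonalized class, so the
  one-sided Kronecker lemmas suffice.\<close>

lemma spd_kron_sum:
  assumes n: "\<And>i. i \<in> {1, 2, 3} \<Longrightarrow> n i > 0"
    and e: "\<And>i. i \<in> {1, 2, 3} \<Longrightarrow> e i > 0"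
    and X: "\<And>i. i \<in> {1, 2, 3} \<Longrightarrow> X i \<in> carrier_mat (n i) (n i)"
      "\<And>i. i \<in> {1, 2, 3} \<Longrightarrow> spd_mat (X i)"
  shows "spd_mat (kron_sum e n X)"
proof -
  let ?N = "n 3 * n 2 * n 1"
  have A: "orthogonally_pd (n i) (sine_mat (n i)) (A_mat (n i))" if "i \<in> {1, 2, 3}" for i
    using orthogonally_pd_A_mat[OF n[OF that]] .
  have X': "X 1 \<in> carrier_mat (n 1) (n 1)" "X 2 \<in> carrier_mat (n 2) (n 2)" "X 3 \<in> carrier_mat (n 3) (n 3)"
    "spd_mat (X 1)" "spd_mat (X 2)" "spd_mat (X 3)" using X by auto
  have 0: "spd_mat (A_mat (n 3) \<otimes>\<^sub>k A_mat (n 2) \<otimes>\<^sub>k A_mat (n 1))"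
    by (rule orthogonally_pd_imp_spd[OF orthogonally_pd_kronecker[OF orthogonally_pd_kronecker[OF A A] A]]) auto
  have 1: "spd_mat (A_mat (n 3) \<otimes>\<^sub>k A_mat (n 2) \<otimes>\<^sub>k X 1)"
    by (rule spd_kronecker_left[OF orthogonally_pd_kronecker[OF A A] X'(4,1)]) auto
  have 2: "spd_mat (A_mat (n 3) \<otimes>\<^sub>k X 2 \<otimes>\<^sub>k A_mat (n 1))"
    by (rule spd_kronecker_right[OF A spd_kronecker_left[OF A X'(5,2)]
          kronecker_carrier[OF A_mat_carrier X'(2)]]) auto
  have 3: "spd_mat (X 3 \<otimes>\<^sub>k A_mat (n 2) \<otimes>\<^sub>k A_mat (n 1))"
    by (rule spd_kronecker_right[OF A spd_kronecker_right[OF A X'(6,3)]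
          kronecker_carrier[OF X'(3) A_mat_carrier]]) auto
  have "e 1 > 0" "e 2 > 0" "e 3 > 0" using e by auto
  then show ?thesis
    unfolding kron_sum_def using 0 1 2 3 X'
    by (intro spd_mat_add[of _ _ ?N] spd_mat_smult[of _ ?N]) auto
qed

text \<open>For an eigenvector \<open>v\<close> put \<open>y = inv_sqrt_mat P *\<^sub>v v\<close>.
  Then \<open>y\<close> has \<open>P\<close>-form \<open>v \<bullet> v\<close> and
  \<open>A\<close>-form \<open>lam\<close> times that, so the form of \<open>c A + d P\<close> at
  \<open>y\<close> is \<open>(c lam + d) (v \<bullet> v)\<close>, and its sign bounds
  \<open>lam\<close>.\<close>

lemma preconditioned_eigenvalue_bounds:
  assumes P: "orthogonally_pd N U P" and A: "A \<in> carrier_mat N N" "symmetric_mat A"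
    and low: "spd_mat (2 \<cdot>\<^sub>m A + (- 1) \<cdot>\<^sub>m P)" and high: "spd_mat ((- 2) \<cdot>\<^sub>m A + 3 \<cdot>\<^sub>m P)"
  defines "Q \<equiv> inv_sqrt_mat P * A * inv_sqrt_mat P"
  shows "symmetric_mat Q" and "eigenvalue Q lam \<Longrightarrow> 1/2 < lam \<and> lam < 3/2"
proof -
  define W where "W = inv_sqrt_mat P"
  have W: "W \<in> carrier_mat N N" "transpose_mat W = W" "W * P * W = 1\<^sub>m N"
    using inv_sqrt_mat_props[OF P] by (simp_all add: W_def)
  have Pc: "P \<in> carrier_mat N N" using orthogonally_pd_carrier[OF P] .
  note assoc = assoc_mult_mat[of _ N N _ N _ N] mult_carrier_mat[of _ N N _ N]
  show "symmetric_mat Q"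
    using W A unfolding symmetric_mat_def Q_def W_def[symmetric]
    by (simp add: transpose_mult[of _ N N _ N] assoc)
  have Qc: "Q \<in> carrier_mat N N" using W A unfolding Q_def W_def[symmetric] by (simp add: assoc)
  assume "eigenvalue Q lam"
  then obtain v where v: "v \<in> carrier_vec N" "v \<noteq> 0\<^sub>v N" "Q *\<^sub>v v = lam \<cdot>\<^sub>v v"
    using Qc unfolding eigenvalue_def eigenvector_def by auto
  define y where "y = W *\<^sub>v v"
  have y: "y \<in> carrier_vec N" using W v by (simp add: y_def)
  have cong: "v \<bullet> ((W * X * W) *\<^sub>v v) = y \<bullet> (X *\<^sub>v y)" if X: "X \<in> carrier_mat N N" for X
  proof -
    have "(W * X * W) *\<^sub>v v = W *\<^sub>v (X *\<^sub>v y)"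
      using W X v by (simp add: y_def assoc_mult_mat_vec[of _ N N _ N] assoc)
    also have "v \<bullet> \<dots> = y \<bullet> (X *\<^sub>v y)"
      using transpose_vec_mult_scalar[of W N N "X *\<^sub>v y" v] W X y v by (simp add: y_def)
    finally show ?thesis .
  qed
  have vv: "v \<bullet> v = y \<bullet> (P *\<^sub>v y)" using cong[OF Pc] W(3) v by simp
  have lvv: "lam * (v \<bullet> v) = y \<bullet> (A *\<^sub>v y)"
    using cong[OF A(1)] v unfolding Q_def W_def[symmetric] by simp
  have "v \<bullet> v > 0" using spd_matD(2)[OF spd_mat_diag[of N "\<lambda>_. 1"] mat_diag_dim v(1,2)] v by simp
  \<comment> \<open>The \<open>P\<close>-form of \<open>y\<close> is
    \<open>v \<bullet> v > 0\<close>, which rules out \<open>y = 0\<close> without inverting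
    \<open>W\<close>.\<close>
  moreover from this have y0: "y \<noteq> 0\<^sub>v N" unfolding vv using Pc by auto
  have comb: "y \<bullet> ((c \<cdot>\<^sub>m A + d \<cdot>\<^sub>m P) *\<^sub>v y) = (c * lam + d) * (v \<bullet> v)" for c d
  proof -
    have "y \<bullet> ((c \<cdot>\<^sub>m A + d \<cdot>\<^sub>m P) *\<^sub>v y) = y \<bullet> ((c \<cdot>\<^sub>m A) *\<^sub>v y) + y \<bullet> ((d \<cdot>\<^sub>m P) *\<^sub>v y)"
      using A(1) Pc y by (simp add: add_mult_distrib_mat_vec[of _ N N] scalar_prod_add_distrib[of _ N]
          mult_mat_vec_carrier[of _ N N])
    also have "\<dots> = c * (lam * (v \<bullet> v)) + d * (v \<bullet> v)"
      by (simp only: quadratic_form_smult[OF A(1) y] quadratic_form_smult[OF Pc y] vv[symmetric] lvv[symmetric])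
    finally show ?thesis by (simp add: algebra_simps)
  qed
  have "(2 * lam + - 1) * (v \<bullet> v) > 0"
    using spd_matD(2)[OF low _ y y0] A(1) Pc unfolding comb by simp
  moreover have "(- 2 * lam + 3) * (v \<bullet> v) > 0"
    using spd_matD(2)[OF high _ y y0] A(1) Pc unfolding comb by simp
  ultimately show "1/2 < lam \<and> lam < 3/2" by (simp add: zero_less_mult_iff)
qed

theorem theorem3p1:
  fixes \<alpha> \<beta> \<gamma> T \<Delta>t :: real
    and \<delta> a b kp km h \<eta> :: "nat \<Rightarrow> real"
    and n :: "nat \<Rightarrow> nat"
    and M :: nat
    and A P Q :: "real mat"
  assumes "\<alpha> \<in> {0<..<1}" and "\<beta> \<in> {0<..<1}" and "\<gamma> \<in> {0<..<1}"
    and "\<delta> 1 = \<alpha>" and "\<delta> 2 = \<beta>" and "\<delta> 3 = \<gamma>"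
    and "\<And>i. i \<in> {1, 2, 3} \<Longrightarrow> a i < b i"
    and "\<And>i. i \<in> {1, 2, 3} \<Longrightarrow> kp i > 0"
    and "\<And>i. i \<in> {1, 2, 3} \<Longrightarrow> km i > 0"
    and "T > 0" and "M > 0"
    and "\<And>i. i \<in> {1, 2, 3} \<Longrightarrow> n i > 0"
    and "\<Delta>t = T / real M"
    and "\<And>i. i \<in> {1, 2, 3} \<Longrightarrow> h i = (b i - a i) / (real (n i) + 1)"
    and "\<And>i. i \<in> {1, 2, 3} \<Longrightarrow> \<eta> i = eta \<Delta>t (h i) (\<delta> i)"
    and "A = coeff_mat \<eta> n \<delta> kp km"
    and "P = precond_mat \<eta> n \<delta> kp km"
    and "Q = inv_sqrt_mat P * A * inv_sqrt_mat P"
    and "\<And>i. i \<in> {1, 2, 3} \<Longrightarrow> kp i = km i"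
  shows "symmetric_mat Q \<and> (\<forall>lam. eigenvalue Q lam \<longrightarrow> 1/2 < lam \<and> lam < 3/2)"
proof -
  note n = assms(12)
  have d: "0 < \<delta> i" "\<delta> i < 1" if "i \<in> {1, 2, 3}" for i using that assms(1-6) by auto
  have \<eta>: "\<eta> i > 0" if i: "i \<in> {1, 2, 3}" for i
  proof -
    have "h i > 0" using assms(14)[OF i] assms(7)[OF i] by simp
    then show ?thesis
      using assms(10,11,13,15) i d[OF i] by (simp add: eta_def Gamma_real_pos)
  qed
  let ?N = "n 3 * n 2 * n 1"
  \<comment> \<open>Taking \<open>kp\<close> for both constants makes \<open>B i\<close> Toeplitz at
    every index; the assumption \<open>kp i = km i\<close> identifies it with the given matrix at
    the indices 1, 2, 3 that \<open>kron_sum\<close> reads.\<close>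
  define B where "B i = B_mat (n i) (\<delta> i) (kp i) (kp i)" for i
  define C where "C i = tau_mat (sym_part (B i))" for i
  have B: "B i \<in> carrier_mat (n i) (n i)" "symmetric_mat (B i)" for i
    unfolding B_def B_mat_toeplitz by (simp_all add: symmetric_toeplitz)
  have tau: "C i \<in> carrier_mat (n i) (n i)" "orthogonally_pd (n i) (sine_mat (n i)) (C i)"
    "spd_mat (2 \<cdot>\<^sub>m B i + (- 1) \<cdot>\<^sub>m C i)" "spd_mat ((- 2) \<cdot>\<^sub>m B i + 3 \<cdot>\<^sub>m C i)"
    if i: "i \<in> {1, 2, 3}" for i
    unfolding C_def B_def using tau_riesz[OF assms(8)[OF i] d[OF i] n[OF i]] by blast+
  have A: "A = kron_sum \<eta> n B" and P: "P = kron_sum \<eta> n C"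
    unfolding assms(16,17) coeff_mat_def precond_mat_def kron_sum_def C_def B_def
    using assms(19) by simp_all
  have Ac: "A \<in> carrier_mat ?N ?N" unfolding A by (rule kron_sum_carrier) (use B in auto)
  have As: "symmetric_mat A"
  proof -
    have "symmetric_mat (A_mat m)" for m
      by (auto simp: symmetric_mat_def A_mat_def)
    then have k: "symmetric_mat (A_mat (n 3) \<otimes>\<^sub>k A_mat (n 2) \<otimes>\<^sub>k A_mat (n 1))"
       "symmetric_mat (A_mat (n 3) \<otimes>\<^sub>k A_mat (n 2) \<otimes>\<^sub>k B 1)"
       "symmetric_mat (A_mat (n 3) \<otimes>\<^sub>k B 2 \<otimes>\<^sub>k A_mat (n 1))"
       "symmetric_mat (B 3 \<otimes>\<^sub>k A_mat (n 2) \<otimes>\<^sub>k A_mat (n 1))"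
      using B(2) by (simp_all add: symmetric_kronecker)
    show ?thesis
      using k B(1) unfolding A kron_sum_def symmetric_mat_def
      by (simp add: transpose_add[of _ ?N ?N] transpose_smult_mat)
  qed
  have low: "spd_mat (2 \<cdot>\<^sub>m A + (- 1) \<cdot>\<^sub>m P)"
  proof -
    have "spd_mat (kron_sum \<eta> n (\<lambda>i. 2 \<cdot>\<^sub>m B i + (- 1) \<cdot>\<^sub>m C i))"
      by (rule spd_kron_sum[OF n \<eta>]) (use B tau in auto)
    then show ?thesis
      unfolding A P by (subst (asm) kron_sum_affine[OF B(1) tau(1)]) auto
  qed
  have high: "spd_mat ((- 2) \<cdot>\<^sub>m A + 3 \<cdot>\<^sub>m P)"
  proof -
    have "spd_mat (kron_sum \<eta> n (\<lambda>i. (- 2) \<cdot>\<^sub>m B i + 3 \<cdot>\<^sub>m C i))"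
      by (rule spd_kron_sum[OF n \<eta>]) (use B tau in auto)
    then show ?thesis
      unfolding A P by (subst (asm) kron_sum_affine[OF B(1) tau(1)]) auto
  qed
  have Ppd: "orthogonally_pd ?N (sine_mat (n 3) \<otimes>\<^sub>k sine_mat (n 2) \<otimes>\<^sub>k sine_mat (n 1)) P"
    unfolding P by (rule orthogonally_pd_kron_sum[OF n \<eta> tau(2)])
  show ?thesis
    using preconditioned_eigenvalue_bounds[OF Ppd Ac As low high] unfolding assms(18) by blast
qed

end
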